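(* The Hamiltonian system with Hamiltonian $$H=\sum_{i,j=1}^n c_{i,j}\,\rho_{i,0}\,\rho_{j,1}+\sum_{i=1}^n(1+\phi_{i,1})e^{\phi_{i,0}}$$ on the $4n$-dimensional phase space with global coordinates $\rho_{i,0},\rho_{i,1},\phi_{i,0}\in\mathbb R$, $\phi_{i,1}\in\mathbb R^+$ ($1\le i\le n$) and symplectic form $$\omega_Z=\sum_{i=1}^n\left(d\rho_{i,0}\wedge d\phi_{i,1}+d\rho_{i,1}\wedge d\phi_{i,0}\right)$$ is completely integrable in the Liouville sense.
   Context: $(c_{i,j})_{n\times n}$ is the Cartan matrix of a (real split) simple Lie algebra $\mathfrak g$ of rank $n$. The paper's standing normalization is that, for a suitable positive multiple $\kappa$ of the Killing form and simple roots $\alpha_1,\dots,\alpha_n$, one has $\kappa(\alpha_i,\alpha_i)=2$ for all $i$ and $\kappa(\alpha_i,\alpha_j)=c_{i,j}$. The phase space is the manifold $Z$ of normalized Jacobi elements of the Takiff algebra $\mathfrak g_1=\mathfrak g\otimes\mathbb R[t]/(t^2)$, i.e. of elements $y=\mathbf f+\sum_{i,\,j\in\{0,1\}}\rho_{i,j}h_i(j)+\sum_{i,\,j\in\{0,1\}}\gamma_{i,j}e_{\alpha_i}(j)$ with $\rho_{i,j}\in\mathbb R$, $\gamma_{i,j}\in\mathbb R^+$, where $x(j)=x\otimes t^j$, $e_{\pm\alpha_i}$ are simple root vectors with $\kappa(e_{\alpha_i},e_{-\alpha_i})=1$, $h_i=[e_{\alpha_i},e_{-\alpha_i}]$, $\mathbf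 f=\sum_{i}(e_{-\alpha_i}(0)+e_{-\alpha_i}(1))$; the coordinates $\phi$ are given by $\gamma_{i,0}=\exp(\phi_{i,0})$ and $\gamma_{i,1}/\gamma_{i,0}=\phi_{i,1}$. Then $H(y)=\frac12Q(y,y)$, where $Q(x(i),y(j))=\delta_{i+j,1}\kappa(x,y)$. Completely integrable in the Liouville sense means: there exist $2n$ smooth functions (including $H$, or with $H$ a function of them) on the $4n$-dimensional phase space that pairwise Poisson commute and are functionally independent (differentials linearly independent on a dense open set). *)

theory Defs
  imports "HOL-Analysis.Analysis"
begin

section \<open>Split simple real Lie algebras and their Cartan matrices\<close>

text \<open>A finite-dimensional real Lie algebra is given by its bracket on a Euclidean space.
  The inner product only supplies the coordinates in which traces are computed.\<close>

definition lie_algebra :: "('g::euclidean_space \<Rightarrow> 'g \<Rightarrow> 'g) \<Rightarrow> bool" where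
  "lie_algebra br \<longleftrightarrow> bilinear br \<and> (\<forall>x. br x x = 0) \<and>
     (\<forall>x y z. br x (br y z) + br y (br z x) + br z (br x y) = 0)"

definition lie_ideal :: "('g::euclidean_space \<Rightarrow> 'g \<Rightarrow> 'g) \<Rightarrow> 'g set \<Rightarrow> bool" where
  "lie_ideal br I \<longleftrightarrow> subspace I \<and> (\<forall>x. \<forall>y\<in>I. br x y \<in> I)"

definition simple_lie_algebra :: "('g::euclidean_space \<Rightarrow> 'g \<Rightarrow> 'g) \<Rightarrow> bool" where
  "simple_lie_algebra br \<longleftrightarrow> lie_algebra br \<and> (\<exists>x y. br x y \<noteq> 0) \<and>
     (\<forall>I. lie_ideal br I \<longrightarrow> I = {0} \<or> I = UNIV)"

definition linear_trace :: "('g::euclidean_space \<Rightarrow> 'g) \<Rightarrow> real" where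
  "linear_trace f = (\<Sum>b\<in>Basis. f b \<bullet> b)"

definition killing_form :: "('g::euclidean_space \<Rightarrow> 'g \<Rightarrow> 'g) \<Rightarrow> 'g \<Rightarrow> 'g \<Rightarrow> real" where
  "killing_form br x y = linear_trace (br x \<circ> br y)"

text \<open>A Cartan subalgebra of a semisimple Lie algebra is a maximal abelian (that is,
  self-centralizing) subalgebra with semisimple adjoint action. It is split if each
  of its elements acts diagonalizably over the reals, that is, if the real eigenvectors span.\<close>

definition split_cartan_subalgebra ::
    "('g::euclidean_space \<Rightarrow> 'g \<Rightarrow> 'g) \<Rightarrow> 'g set \<Rightarrow> bool" where
  "split_cartan_subalgebra br \<hh> \<longleftrightarrow> subspace \<hh> \<and>
     \<hh> = {x. \<forall>y\<in>\<hh>. br x y = 0} \<and>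
     (\<forall>x\<in>\<hh>. span {v. \<exists>r. br x v = r *\<^sub>R v} = UNIV)"

text \<open>Elements of the dual of \<open>\<hh>\<close> are represented by real functions of which only the
  restriction to \<open>\<hh>\<close> matters; that the restriction of a root is linear follows from
  the eigenvector equation.\<close>

definition is_root ::
    "('g::euclidean_space \<Rightarrow> 'g \<Rightarrow> 'g) \<Rightarrow> 'g set \<Rightarrow> ('g \<Rightarrow> real) \<Rightarrow> bool" where
  "is_root br \<hh> \<beta> \<longleftrightarrow> (\<exists>x\<in>\<hh>. \<beta> x \<noteq> 0) \<and>
     (\<exists>v. v \<noteq> 0 \<and> (\<forall>x\<in>\<hh>. br x v = \<beta> x *\<^sub>R v))"

definition simple_roots ::
    "('g::euclidean_space \<Rightarrow> 'g \<Rightarrow> 'g) \<Rightarrow> 'g set \<Rightarrow> ('n::finite \<Rightarrow> 'g \<Rightarrow> real) \<Rightarrow> bool" where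
  "simple_roots br \<hh> \<alpha> \<longleftrightarrow> (\<forall>i. is_root br \<hh> (\<alpha> i)) \<and>
     (\<forall>a. (\<forall>x\<in>\<hh>. (\<Sum>i\<in>UNIV. a i * \<alpha> i x) = 0) \<longrightarrow> (\<forall>i. a i = 0)) \<and>
     (\<forall>\<beta>. is_root br \<hh> \<beta> \<longrightarrow> (\<exists>k :: 'n \<Rightarrow> nat.
        (\<forall>x\<in>\<hh>. \<beta> x = (\<Sum>i\<in>UNIV. real (k i) * \<alpha> i x)) \<or>
        (\<forall>x\<in>\<hh>. \<beta> x = - (\<Sum>i\<in>UNIV. real (k i) * \<alpha> i x))))"

definition dual_vector ::
    "('g \<Rightarrow> 'g \<Rightarrow> real) \<Rightarrow> 'g set \<Rightarrow> ('g \<Rightarrow> real) \<Rightarrow> 'g" where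
  "dual_vector \<kappa> \<hh> \<beta> = (THE t. t \<in> \<hh> \<and> (\<forall>x\<in>\<hh>. \<kappa> t x = \<beta> x))"

definition dual_form ::
    "('g \<Rightarrow> 'g \<Rightarrow> real) \<Rightarrow> 'g set \<Rightarrow> ('g \<Rightarrow> real) \<Rightarrow> ('g \<Rightarrow> real) \<Rightarrow> real" where
  "dual_form \<kappa> \<hh> \<beta> \<gamma> = \<kappa> (dual_vector \<kappa> \<hh> \<beta>) (dual_vector \<kappa> \<hh> \<gamma>)"

definition cartan_matrix ::
    "('g::euclidean_space \<Rightarrow> 'g \<Rightarrow> 'g) \<Rightarrow> 'g set \<Rightarrow> ('n::finite \<Rightarrow> 'g \<Rightarrow> real) \<Rightarrow> real ^ 'n ^ 'n" where
  "cartan_matrix br \<hh> \<alpha> = (\<chi> i j.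
     2 * dual_form (killing_form br) \<hh> (\<alpha> i) (\<alpha> j) /
         dual_form (killing_form br) \<hh> (\<alpha> i) (\<alpha> i))"

section \<open>Liouville integrability on open subsets of a Euclidean space\<close>

primrec Ck_on :: "nat \<Rightarrow> 'a::euclidean_space set \<Rightarrow> ('a \<Rightarrow> 'b::real_normed_vector) \<Rightarrow> bool" where
  "Ck_on 0 S f \<longleftrightarrow> continuous_on S f"
| "Ck_on (Suc k) S f \<longleftrightarrow> (\<forall>x\<in>S. f differentiable at x) \<and>
     (\<forall>v. Ck_on k S (\<lambda>x. frechet_derivative f (at x) v))"

text \<open>Only meant for open \<open>S\<close>.\<close>

definition smooth_on :: "'a::euclidean_space set \<Rightarrow> ('a \<Rightarrow> 'b::real_normed_vector) \<Rightarrow> bool" where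
  "smooth_on S f \<longleftrightarrow> (\<forall>k. Ck_on k S f)"

text \<open>A symplectic form with constant coefficients, the tangent spaces being identified with
  the ambient vector space; it is automatically closed.\<close>

definition symplectic_form :: "('a::euclidean_space \<Rightarrow> 'a \<Rightarrow> real) \<Rightarrow> bool" where
  "symplectic_form \<omega> \<longleftrightarrow> bilinear \<omega> \<and> (\<forall>v. \<omega> v v = 0) \<and>
     (\<forall>u. (\<forall>v. \<omega> u v = 0) \<longrightarrow> u = 0)"

definition hamiltonian_field ::
    "('a::euclidean_space \<Rightarrow> 'a \<Rightarrow> real) \<Rightarrow> ('a \<Rightarrow> real) \<Rightarrow> 'a \<Rightarrow> 'a" where
  "hamiltonian_field \<omega> f x = (THE X. \<forall>v. \<omega> X v = frechet_derivative f (at x) v)"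

definition poisson_bracket ::
    "('a::euclidean_space \<Rightarrow> 'a \<Rightarrow> real) \<Rightarrow> ('a \<Rightarrow> real) \<Rightarrow> ('a \<Rightarrow> real) \<Rightarrow> 'a \<Rightarrow> real" where
  "poisson_bracket \<omega> f g x = \<omega> (hamiltonian_field \<omega> f x) (hamiltonian_field \<omega> g x)"

definition functionally_independent_on ::
    "'a::euclidean_space set \<Rightarrow> ('a \<Rightarrow> real ^ 'k::finite) \<Rightarrow> bool" where
  "functionally_independent_on M F \<longleftrightarrow> (\<exists>U. open U \<and> U \<subseteq> M \<and> M \<subseteq> closure U \<and>
     (\<forall>x\<in>U. \<forall>a :: real ^ 'k.
        (\<forall>v. (\<Sum>i\<in>UNIV. a $ i * frechet_derivative (\<lambda>y. F y $ i) (at x) v) = 0) \<longrightarrow> a = 0))"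

text \<open>The components of \<open>F\<close> are the integrals of motion; their number is half the dimension
  of the phase space \<open>M\<close>. The Hamiltonian \<open>H\<close> is one of them or a smooth function of them.\<close>

definition liouville_integrable_by ::
    "'a::euclidean_space set \<Rightarrow> ('a \<Rightarrow> 'a \<Rightarrow> real) \<Rightarrow> ('a \<Rightarrow> real) \<Rightarrow> ('a \<Rightarrow> real ^ 'k::finite) \<Rightarrow> bool"
  where
  "liouville_integrable_by M \<omega> H F \<longleftrightarrow>
     open M \<and> symplectic_form \<omega> \<and> smooth_on M H \<and>
     DIM('a) = 2 * CARD('k) \<and> smooth_on M F \<and>
     (\<forall>i j. \<forall>x\<in>M. poisson_bracket \<omega> (\<lambda>y. F y $ i) (\<lambda>y. F y $ j) x = 0) \<and>
     functionally_independent_on M F \<and>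
     ((\<exists>i. \<forall>x\<in>M. H x = F x $ i) \<or>
      (\<exists>V g. open V \<and> F ` M \<subseteq> V \<and> smooth_on V g \<and> (\<forall>x\<in>M. H x = g (F x))))"

section \<open>The Hamiltonian system\<close>

text \<open>Points are listed as \<open>(\<rho>\<^sub>0, \<rho>\<^sub>1, \<phi>\<^sub>0, \<phi>\<^sub>1)\<close>, where \<open>\<rho>\<^sub>0 $ i\<close> stands for the coordinate
  with indices \<open>i, 0\<close>, and so on.\<close>

type_synonym 'n coords = "(real ^ 'n) \<times> (real ^ 'n) \<times> (real ^ 'n) \<times> (real ^ 'n)"

definition phase_space :: "'n::finite coords set" where
  "phase_space = {(\<rho>0, \<rho>1, \<phi>0, \<phi>1). \<forall>i. \<phi>1 $ i > 0}"

definition hamiltonian :: "real ^ 'n ^ 'n \<Rightarrow> 'n::finite coords \<Rightarrow> real" where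
  "hamiltonian c = (\<lambda>(\<rho>0, \<rho>1, \<phi>0, \<phi>1).
     (\<Sum>i\<in>UNIV. \<Sum>j\<in>UNIV. c $ i $ j * \<rho>0 $ i * \<rho>1 $ j) +
     (\<Sum>i\<in>UNIV. (1 + \<phi>1 $ i) * exp (\<phi>0 $ i)))"

text \<open>With \<open>(d\<rho> \<and> d\<phi>) (u, v) = d\<rho> u * d\<phi> v - d\<rho> v * d\<phi> u\<close>.\<close>

definition omega_Z :: "'n::finite coords \<Rightarrow> 'n coords \<Rightarrow> real" where
  "omega_Z = (\<lambda>(r0, r1, p0, p1) (s0, s1, q0, q1).
     (\<Sum>i\<in>UNIV. (r0 $ i * q1 $ i - s0 $ i * p1 $ i) + (r1 $ i * q0 $ i - s1 $ i * p0 $ i)))"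

end

theory Submission
  imports Defs
begin

text \<open>
  The system is the open Toda lattice of the Takiff algebra \<open>\<gg> \<otimes> \<real>[t]/(t\<^sup>2)\<close>. With simple root
  vectors \<open>e i\<close>, \<open>f i\<close> and \<open>h i\<close> the vector of the Cartan subalgebra dual to the simple root
  \<open>\<alpha> i\<close>, a point of the phase space is turned into the Jacobi element \<open>L0 + t L1\<close> with
  \<open>L0 = \<Sum> f i + \<rho>0 i h i + exp (\<phi>0 i) e i\<close> and \<open>L1 = \<Sum> f i + \<rho>1 i h i + \<phi>1 i exp (\<phi>0 i) e i\<close>,
  and then \<open>H = \<kappa> (L0, L1)\<close>. Every invariant function of the Takiff algebra is an integral. The
  invariants used here are the two coefficients of \<open>tr (ad (L0 + t L1) ^ (k + 1)) / (k + 1)\<close>, that is,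
  \<open>tr (ad L0 ^ (k + 1)) / (k + 1)\<close> and \<open>tr (ad L0 ^ k ad L1)\<close>; for \<open>k = 1\<close> the second one is the
  Killing form of \<open>L0\<close> and \<open>L1\<close>, hence proportional to \<open>H\<close>.

  Involution is the argument of Adler, Kostant and Symes. The Killing form is nondegenerate, since its
  radical is an ideal and the form is not zero. So an invariant has a gradient in the Takiff algebra, and this gradient
  commutes with \<open>L0 + t L1\<close> (\<open>br_gradient_power\<close>, \<open>br_gradient_deriv\<close>). In canonical coordinates
  the Poisson bracket of two functions with gradients \<open>X\<close> and \<open>Y\<close> is the pairing of \<open>L0 + t L1\<close> with
  \<open>[Y', X']\<close>, where the prime denotes the projection to the lower Borel subalgebra along the upper
  nilpotent one. Writing \<open>X' = X - X''\<close> with \<open>X''\<close> upper nilpotent, all terms but \<open>[Y'', X'']\<close>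
  vanish by invariance, and this last one has height at least \<open>2\<close> and is orthogonal to \<open>L0 + t L1\<close>
  (\<open>skew_pairing_gradients\<close>).

  For the independence it suffices to differentiate along \<open>\<rho>0\<close> and \<open>\<rho>1\<close>. Since the traces
  of the first kind depend on \<open>L0\<close> only, the Jacobian matrix is block triangular, and both diagonal blocks are
  the matrix \<open>J\<close> with entries \<open>tr (ad L0 ^ k ad (h i))\<close>. At a generic element \<open>x\<close> of the Cartan
  subalgebra each \<open>ad (h j)\<close> is a polynomial in \<open>ad x\<close> by Lagrange interpolation of the weights;
  thus a vector orthogonal to \<open>tr (ad x ^ k ad (h i))\<close> for all \<open>k\<close> is orthogonal to all
  \<open>h j\<close> and vanishes, and \<open>n\<close> exponents \<open>k\<close>, the exponent \<open>1\<close> among them, can be chosen such that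
  the determinant of \<open>J\<close> does not vanish at \<open>x\<close> (\<open>exists_nonsingular_jacobian\<close>). Along each
  line \<open>L0 + s x\<close> the determinant is a polynomial in \<open>s\<close> whose coefficient of highest order is its
  value at \<open>x\<close>, so it has finitely many zeros (\<open>finite_singular_on_line\<close>), and the points at
  which it does not vanish are dense.
\<close>

section \<open>Smooth functions\<close>

text \<open>Any formula for the derivative on \<open>S\<close> can replace \<open>frechet_derivative\<close>: the two agree on
  the open set \<open>S\<close> only, and differentiability of class \<open>k\<close> on \<open>S\<close> must be seen not to depend on
  the values elsewhere.\<close>

lemma Ck_on_SucI:
  assumes "open S" "\<And>x. x \<in> S \<Longrightarrow> (f has_derivative f' x) (at x)" "\<And>v. Ck_on k S (\<lambda>x. f' x v)"
  shows "Ck_on (Suc k) S f"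
proof -
  have cong: "Ck_on k S h" if "\<And>x. x \<in> S \<Longrightarrow> g x = h x" "Ck_on k S g"
    for k and g h :: "'a \<Rightarrow> 'c::real_normed_vector"
    using that
  proof (induction k arbitrary: g h)
    case 0
    then show ?case by (simp cong: continuous_on_cong)
  next
    case (Suc k)
    have D: "(h has_derivative frechet_derivative g (at x)) (at x)" if "x \<in> S" for x
    proof (rule has_derivative_transform_within_open[OF _ \<open>open S\<close> that])
      show "(g has_derivative frechet_derivative g (at x)) (at x)"
        using Suc.prems(2) that frechet_derivative_works[of g] by simp
    qed (rule Suc.prems(1))
    have "Ck_on k S (\<lambda>x. frechet_derivative h (at x) v)" for v
    proof (rule Suc.IH)
      show "frechet_derivative g (at x) v = frechet_derivative h (at x) v" if "x \<in> S" for x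
        by (rule fun_cong[OF frechet_derivative_at[OF D[OF that]]])
      show "Ck_on k S (\<lambda>x. frechet_derivative g (at x) v)"
        using Suc.prems(2) by simp
    qed
    moreover have "h differentiable at x" if "x \<in> S" for x
      unfolding differentiable_def using D[OF that] by blast
    ultimately show ?case by simp
  qed
  have "Ck_on k S (\<lambda>x. frechet_derivative f (at x) v)" for v
    by (rule cong[OF fun_cong[OF frechet_derivative_at[OF assms(2)]] assms(3)])
  moreover have "f differentiable at x" if "x \<in> S" for x
    unfolding differentiable_def using assms(2)[OF that] by blast
  ultimately show ?thesis by simp
qed

lemma Ck_on_SucD:
  assumes "Ck_on (Suc k) S f" "x \<in> S"
  shows "(f has_derivative frechet_derivative f (at x)) (at x)"
  using assms by (simp add: frechet_derivative_works[symmetric])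

lemma Ck_on_Suc_imp_Ck_on: "Ck_on (Suc k) S f \<Longrightarrow> Ck_on k S f"
proof (induction k arbitrary: f)
  case 0
  then show ?case
    by (simp add: continuous_at_imp_continuous_on differentiable_imp_continuous_within)
next
  case (Suc k)
  from Suc.prems have "Ck_on k S (\<lambda>x. frechet_derivative f (at x) v)" for v
    unfolding Ck_on.simps(2)[of "Suc k"] by (intro Suc.IH) blast
  with Suc.prems show ?case
    unfolding Ck_on.simps(2)[of "Suc k"] Ck_on.simps(2)[of k S f] by blast
qed

lemma Ck_on_const: "open S \<Longrightarrow> Ck_on k S (\<lambda>x. c)"
proof (induction k arbitrary: c)
  case 0
  then show ?case by simp
next
  case (Suc k)
  show ?case
    by (rule Ck_on_SucI[OF Suc.prems has_derivative_const Suc.IH[OF Suc.prems]])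
qed

lemma Ck_on_bounded_linear:
  assumes "open S" "bounded_linear f" shows "Ck_on k S f"
proof (cases k)
  case 0
  then show ?thesis using assms by (simp add: linear_continuous_on)
next
  case (Suc m)
  have D: "(f has_derivative f) (at x)" for x using assms(2) by (rule bounded_linear_imp_has_derivative)
  show ?thesis
    unfolding Suc by (rule Ck_on_SucI[OF assms(1) D Ck_on_const[OF assms(1)]])
qed

lemma Ck_on_add:
  assumes "open S" "Ck_on k S f" "Ck_on k S g" shows "Ck_on k S (\<lambda>x. f x + g x)"
  using assms(2,3)
proof (induction k arbitrary: f g)
  case 0
  then show ?case by (auto intro: continuous_on_add)
next
  case (Suc k)
  show ?case
  proof (rule Ck_on_SucI[OF \<open>open S\<close>])
    show "((\<lambda>x. f x + g x) has_derivative
        (\<lambda>v. frechet_derivative f (at x) v + frechet_derivative g (at x) v)) (at x)" if "x \<in> S" for x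
      by (rule has_derivative_add[OF Ck_on_SucD[OF Suc.prems(1) that] Ck_on_SucD[OF Suc.prems(2) that]])
    show "Ck_on k S (\<lambda>x. frechet_derivative f (at x) v + frechet_derivative g (at x) v)" for v
      by (rule Suc.IH) (use Suc.prems in simp_all)
  qed
qed

lemma Ck_on_bilinear:
  assumes "open S" "bounded_bilinear b" "Ck_on k S f" "Ck_on k S g"
  shows "Ck_on k S (\<lambda>x. b (f x) (g x))"
  using assms(3,4)
proof (induction k arbitrary: f g)
  case 0
  then show ?case using assms(2) by (auto intro: bounded_bilinear.continuous_on)
next
  case (Suc k)
  show ?case
  proof (rule Ck_on_SucI[OF \<open>open S\<close>])
    show "((\<lambda>x. b (f x) (g x)) has_derivative (\<lambda>v. b (f x) (frechet_derivative g (at x) v) +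
        b (frechet_derivative f (at x) v) (g x))) (at x)" if "x \<in> S" for x
      using Ck_on_SucD[OF Suc.prems(1) that] Ck_on_SucD[OF Suc.prems(2) that]
      by (rule bounded_bilinear.FDERIV[OF assms(2)])
    show "Ck_on k S (\<lambda>x. b (f x) (frechet_derivative g (at x) v) +
        b (frechet_derivative f (at x) v) (g x))" for v
    proof (rule Ck_on_add[OF \<open>open S\<close> Suc.IH Suc.IH])
      show "Ck_on k S f" "Ck_on k S g"
        using Suc.prems by (blast intro: Ck_on_Suc_imp_Ck_on)+
    qed (use Suc.prems in simp_all)
  qed
qed

lemma Ck_on_exp:
  fixes f :: "'a::euclidean_space \<Rightarrow> real"
  assumes "open S" "Ck_on k S f" shows "Ck_on k S (\<lambda>x. exp (f x))"
  using assms(2)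
proof (induction k)
  case 0
  then show ?case by (auto intro: continuous_on_exp)
next
  case (Suc k)
  show ?case
  proof (rule Ck_on_SucI[OF \<open>open S\<close>])
    show "((\<lambda>x. exp (f x)) has_derivative (\<lambda>v. exp (f x) * frechet_derivative f (at x) v)) (at x)"
      if "x \<in> S" for x
      using Ck_on_SucD[OF Suc.prems that] by (auto intro!: derivative_eq_intros)
    show "Ck_on k S (\<lambda>x. exp (f x) * frechet_derivative f (at x) v)" for v
    proof (rule Ck_on_bilinear[OF \<open>open S\<close> bounded_bilinear_mult])
      show "Ck_on k S (\<lambda>x. exp (f x))"
        by (rule Suc.IH[OF Ck_on_Suc_imp_Ck_on[OF Suc.prems]])
    qed (use Suc.prems in simp)
  qed
qed

lemma smooth_on_const: "open S \<Longrightarrow> smooth_on S (\<lambda>x. c)"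
  by (simp add: smooth_on_def Ck_on_const)

lemma smooth_on_bounded_linear: "open S \<Longrightarrow> bounded_linear f \<Longrightarrow> smooth_on S f"
  by (simp add: smooth_on_def Ck_on_bounded_linear)

lemma smooth_on_add: "open S \<Longrightarrow> smooth_on S f \<Longrightarrow> smooth_on S g \<Longrightarrow> smooth_on S (\<lambda>x. f x + g x)"
  by (simp add: smooth_on_def Ck_on_add)

lemma smooth_on_bilinear:
  "open S \<Longrightarrow> bounded_bilinear b \<Longrightarrow> smooth_on S f \<Longrightarrow> smooth_on S g \<Longrightarrow> smooth_on S (\<lambda>x. b (f x) (g x))"
  by (simp add: smooth_on_def Ck_on_bilinear)

lemma smooth_on_exp:
  fixes f :: "'a::euclidean_space \<Rightarrow> real"
  shows "open S \<Longrightarrow> smooth_on S f \<Longrightarrow> smooth_on S (\<lambda>x. exp (f x))"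
  by (simp add: smooth_on_def Ck_on_exp)

lemma smooth_on_sum:
  assumes "open S" "\<And>i. i \<in> I \<Longrightarrow> smooth_on S (f i)"
  shows "smooth_on S (\<lambda>x. \<Sum>i\<in>I. f i x)"
  using assms by (induction I rule: infinite_finite_induct) (auto intro: smooth_on_const smooth_on_add)

lemma smooth_on_vec:
  fixes f :: "'i::finite \<Rightarrow> 'a::euclidean_space \<Rightarrow> real"
  assumes "open S" "\<And>i. smooth_on S (f i)"
  shows "smooth_on S (\<lambda>x. \<chi> i. f i x)"
proof -
  have "(\<lambda>x. \<chi> i. f i x) = (\<lambda>x. \<Sum>i\<in>UNIV. f i x *\<^sub>R axis i 1)"
    by (auto simp: vec_eq_iff axis_def if_distrib cong: if_cong)
  then show ?thesis
    using assms by (auto intro!: smooth_on_sum smooth_on_bilinear[OF _ bounded_bilinear_scaleR] smooth_on_const)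
qed

lemma smooth_on_bracket_power:
  fixes br :: "'g::real_normed_vector \<Rightarrow> 'g \<Rightarrow> 'g"
  assumes "open S" "bounded_bilinear br" "smooth_on S L" "smooth_on S G"
  shows "smooth_on S (\<lambda>x. (br (L x) ^^ k) (G x))"
  using assms by (induction k) (auto intro: smooth_on_bilinear)

section \<open>The Poisson bracket in canonical coordinates\<close>

lemma omega_Z_inner:
  "omega_Z (r0, r1, p0, p1) (s0, s1, q0, q1) = (r0 \<bullet> q1 - s0 \<bullet> p1) + (r1 \<bullet> q0 - s1 \<bullet> p0)"
  by (simp add: omega_Z_def inner_vec_def sum.distrib sum_subtractf)

lemma symplectic_form_omega_Z: "symplectic_form (omega_Z :: 'n::finite coords \<Rightarrow> 'n coords \<Rightarrow> real)"
  unfolding symplectic_form_def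
proof (intro conjI allI impI)
  show "bilinear (omega_Z :: 'n coords \<Rightarrow> 'n coords \<Rightarrow> real)"
    unfolding bilinear_def
    by (auto intro!: linearI simp: omega_Z_inner inner_simps algebra_simps)
  show "omega_Z v v = 0" for v :: "'n coords"
    by (cases v) (simp add: omega_Z_inner)
  fix u :: "'n coords"
  assume *: "\<forall>v. omega_Z u v = 0"
  obtain r0 r1 p0 p1 where u: "u = (r0, r1, p0, p1)" by (metis prod.exhaust)
  have "omega_Z u (- p1, - p0, r1, r0) = 0" using * by blast
  then have "r0 \<bullet> r0 + p1 \<bullet> p1 + (r1 \<bullet> r1 + p0 \<bullet> p0) = 0"
    by (simp add: u omega_Z_inner)
  then have "r0 \<bullet> r0 = 0 \<and> p1 \<bullet> p1 = 0 \<and> r1 \<bullet> r1 = 0 \<and> p0 \<bullet> p0 = 0"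
    by (smt (verit) inner_ge_zero)
  then show "u = 0" by (simp add: u zero_prod_def)
qed

text \<open>The coordinates \<open>\<rho>0\<close> and \<open>\<phi>1\<close> are conjugate, and so are \<open>\<rho>1\<close> and \<open>\<phi>0\<close>; hence the
  exchange of the partial derivatives and the order in which they appear.\<close>

lemma hamiltonian_field_omega_Z:
  assumes "(f has_derivative (\<lambda>(r0, r1, p0, p1). a0 \<bullet> r0 + a1 \<bullet> r1 + b0 \<bullet> p0 + b1 \<bullet> p1)) (at x)"
  shows "hamiltonian_field omega_Z f x = (b1, b0, - a1, - a0)"
  unfolding hamiltonian_field_def
proof (rule the_equality)
  have D: "frechet_derivative f (at x) = (\<lambda>(r0, r1, p0, p1). a0 \<bullet> r0 + a1 \<bullet> r1 + b0 \<bullet> p0 + b1 \<bullet> p1)"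
    using frechet_derivative_at[OF assms] by simp
  show *: "\<forall>v. omega_Z (b1, b0, - a1, - a0) v = frechet_derivative f (at x) v"
    by (auto simp: D omega_Z_inner inner_commute)
  fix X assume X: "\<forall>v. omega_Z X v = frechet_derivative f (at x) v"
  have "bilinear (omega_Z :: 'a coords \<Rightarrow> 'a coords \<Rightarrow> real)"
    using symplectic_form_omega_Z by (auto simp: symplectic_form_def)
  then have "omega_Z (X - (b1, b0, - a1, - a0)) v = 0" for v
    using * X bilinear_lsub by (metis diff_self)
  then have "X - (b1, b0, - a1, - a0) = 0"
    using symplectic_form_omega_Z unfolding symplectic_form_def by blast
  then show "X = (b1, b0, - a1, - a0)" by simp
qed

lemma poisson_bracket_omega_Z:
  assumes "(f has_derivative (\<lambda>(r0, r1, p0, p1). a0 \<bullet> r0 + a1 \<bullet> r1 + b0 \<bullet> p0 + b1 \<bullet> p1)) (at x)"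
    and "(g has_derivative (\<lambda>(r0, r1, p0, p1). a0' \<bullet> r0 + a1' \<bullet> r1 + b0' \<bullet> p0 + b1' \<bullet> p1)) (at x)"
  shows "poisson_bracket omega_Z f g x = (a0 \<bullet> b1' - a0' \<bullet> b1) + (a1 \<bullet> b0' - a1' \<bullet> b0)"
  unfolding poisson_bracket_def hamiltonian_field_omega_Z[OF assms(1)] hamiltonian_field_omega_Z[OF assms(2)]
  by (simp add: omega_Z_inner inner_commute)

section \<open>Traces and Lie algebras\<close>

lemma linear_trace_commute:
  fixes f g :: "'a::euclidean_space \<Rightarrow> 'a"
  assumes "linear f" "linear g"
  shows "linear_trace (\<lambda>z. f (g z)) = linear_trace (\<lambda>z. g (f z))"
proof -
  have *: "linear_trace (\<lambda>z. f (g z)) = (\<Sum>b\<in>Basis. \<Sum>c\<in>Basis. (g b \<bullet> c) * (f c \<bullet> b))" 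
    if "linear f" for f g :: "'a \<Rightarrow> 'a"
  proof -
    have "f (g b) = (\<Sum>c\<in>Basis. (g b \<bullet> c) *\<^sub>R f c)" for b
      by (subst (1) euclidean_representation[of "g b", symmetric])
         (simp add: linear_sum[OF that] linear_scale[OF that])
    then show ?thesis by (simp add: linear_trace_def inner_sum_left)
  qed
  show ?thesis
    unfolding *[OF assms(1)] *[OF assms(2)] by (subst sum.swap) (simp add: mult.commute)
qed

lemma linear_trace_add: "linear_trace (\<lambda>z. f z + g z) = linear_trace f + linear_trace g"
  and linear_trace_diff: "linear_trace (\<lambda>z. f z - g z) = linear_trace f - linear_trace g"
  and linear_trace_scaleR: "linear_trace (\<lambda>z. a *\<^sub>R f z) = a * linear_trace f"
  and linear_trace_sum: "linear_trace (\<lambda>z. \<Sum>i\<in>I. h i z) = (\<Sum>i\<in>I. linear_trace (h i))"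
  by (simp_all add: linear_trace_def inner_simps sum.distrib sum_subtractf sum_distrib_left
      inner_sum_left sum.swap[of _ _ I])

locale lie =
  fixes br :: "'g::euclidean_space \<Rightarrow> 'g \<Rightarrow> 'g"
  assumes lie: "lie_algebra br"
begin

sublocale br: bounded_bilinear br
  using lie by (simp add: lie_algebra_def bilinear_conv_bounded_bilinear)

lemma br_anticommute: "br x y = - br y x"
proof -
  have "br (x + y) (x + y) = 0" "br x x = 0" "br y y = 0"
    using lie by (auto simp: lie_algebra_def)
  then show ?thesis by (simp add: br.add_left br.add_right eq_neg_iff_add_eq_0 add.commute)
qed

lemma jacobi: "br (br x y) z = br x (br y z) - br y (br x z)"
proof -
  have "br x (br y z) + br y (br z x) + br z (br x y) = 0"
    using lie by (simp add: lie_algebra_def)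
  then show ?thesis
    using br_anticommute[of z x] br_anticommute[of z "br x y"]
    by (simp add: br.minus_right algebra_simps)
qed

lemma linear_br: "linear (br x)"
  by (rule bounded_linear.linear[OF br.bounded_linear_right])

lemma linear_br_power: "linear (br x ^^ k)"
proof (induction k)
  case 0
  then show ?case by (simp add: linear_id[unfolded id_def])
next
  case (Suc k)
  then show ?case unfolding funpow.simps by (rule linear_compose[OF _ linear_br])
qed

abbreviation K :: "'g \<Rightarrow> 'g \<Rightarrow> real" where "K \<equiv> killing_form br"

lemma K_eq_trace: "K x y = linear_trace (\<lambda>z. br x (br y z))"
  by (simp add: killing_form_def comp_def)

lemma K_commute: "K x y = K y x"
  unfolding K_eq_trace by (rule linear_trace_commute[OF linear_br linear_br])

lemma trace_ad_bracket:
  assumes "linear M"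
  shows "linear_trace (\<lambda>z. M (br (br a y) z)) = linear_trace (\<lambda>z. M (br a (br y z)) - br a (M (br y z)))"
proof -
  have "linear_trace (\<lambda>z. M (br y (br a z))) = linear_trace (\<lambda>z. br a (M (br y z)))"
    using linear_trace_commute[OF linear_compose[OF linear_br[of y] assms] linear_br[of a]]
    by (simp add: comp_def)
  then show ?thesis
    by (simp add: jacobi linear_diff[OF assms] linear_trace_diff)
qed

lemma K_invariant: "K (br x y) z = K x (br y z)"
proof -
  have "linear_trace (\<lambda>w. br z (br x (br y w))) = linear_trace (\<lambda>w. br x (br y (br z w)))"
    "linear_trace (\<lambda>w. br y (br x (br z w))) = linear_trace (\<lambda>w. br x (br z (br y w)))"
    using linear_trace_commute[OF linear_br[of z] linear_compose[OF linear_br[of y] linear_br[of x]]]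
      linear_trace_commute[OF linear_br[of y] linear_compose[OF linear_br[of z] linear_br[of x]]]
    by (simp_all add: comp_def)
  then show ?thesis
    unfolding K_commute[of "br x y" z] unfolding K_eq_trace trace_ad_bracket[OF linear_br]
    by (simp add: linear_trace_diff)
qed

sublocale K: bounded_bilinear K
proof -
  have "linear (K x)" for x
    by (rule linearI)
      (simp_all add: K_eq_trace br.add_left br.add_right br.scaleR_left br.scaleR_right
        linear_trace_add linear_trace_scaleR)
  then have "bilinear K" by (auto simp: bilinear_def K_commute[of _ x for x])
  then show "bounded_bilinear K" by (simp add: bilinear_conv_bounded_bilinear)
qed

section \<open>Trace polynomials of the adjoint representation\<close>

text \<open>The derivative of \<open>a \<mapsto> ad a ^ k\<close> in the direction \<open>b\<close>, equivalently the coefficient of \<open>t\<close>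
  in \<open>ad (a + t b) ^ k\<close>.\<close>

definition ad_pow_deriv :: "nat \<Rightarrow> 'g \<Rightarrow> 'g \<Rightarrow> 'g \<Rightarrow> 'g" where
  "ad_pow_deriv k a b z = (\<Sum>j<k. (br a ^^ j) (br b ((br a ^^ (k - Suc j)) z)))"

lemma linear_ad_pow_deriv: "linear (ad_pow_deriv k a b)"
  unfolding ad_pow_deriv_def
  by (intro linear_compose_sum ballI linear_compose[OF _ linear_br_power, unfolded comp_def]
      linear_compose[OF _ linear_br, unfolded comp_def] linear_br_power)

lemma ad_pow_deriv_Suc: "ad_pow_deriv (Suc k) a b z = br b ((br a ^^ k) z) + br a (ad_pow_deriv k a b z)"
  unfolding ad_pow_deriv_def sum.lessThan_Suc_shift by (simp add: br.sum_right)

text \<open>Splitting off the other end of the product. Comparing both recursions gives the commutation of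
  \<open>ad (a + t b)\<close> with its \<open>k\<close>-th power to first order in \<open>t\<close>.\<close>

lemma ad_pow_deriv_Suc': "ad_pow_deriv (Suc k) a b z = ad_pow_deriv k a b (br a z) + (br a ^^ k) (br b z)"
proof -
  have "(br a ^^ (k - j)) z = (br a ^^ (k - Suc j)) (br a z)" if "j < k" for j
    using that by (metis Suc_diff_Suc comp_apply funpow_Suc_right)
  then show ?thesis by (simp add: ad_pow_deriv_def)
qed

lemma has_derivative_br_power:
  assumes L: "(L has_derivative L') (at x)" and Z: "(Z has_derivative Z') (at x)"
  shows "((\<lambda>x. (br (L x) ^^ k) (Z x)) has_derivative
    (\<lambda>v. (br (L x) ^^ k) (Z' v) + ad_pow_deriv k (L x) (L' v) (Z x))) (at x)"
proof (induction k)
  case 0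
  show ?case using Z by (simp add: ad_pow_deriv_def)
next
  case (Suc k)
  show ?case
    by (rule has_derivative_eq_rhs, simp, rule br.FDERIV[OF L Suc])
       (auto simp: ad_pow_deriv_Suc br.add_right)
qed

lemma has_derivative_linear_trace:
  assumes "\<And>z. ((\<lambda>x. M x z) has_derivative (\<lambda>v. M' v z)) (at x)"
  shows "((\<lambda>x. linear_trace (M x)) has_derivative (\<lambda>v. linear_trace (M' v))) (at x)"
  unfolding linear_trace_def
  by (intro has_derivative_sum has_derivative_inner_left assms)

text \<open>By the cyclic symmetry of the trace the direction of differentiation can be moved to the last
  place, where the gradient can be read off.\<close>

lemma has_derivative_trace_power_times:
  assumes A: "(A has_derivative A') (at x)" and B: "(B has_derivative B') (at x)"
  shows "((\<lambda>x. linear_trace (\<lambda>z. (br (A x) ^^ k) (br (B x) z))) has_derivative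
    (\<lambda>v. linear_trace (\<lambda>z. (br (A x) ^^ k) (br (B' v) z)) +
         linear_trace (\<lambda>z. ad_pow_deriv k (A x) (B x) (br (A' v) z)))) (at x)"
proof -
  have "((\<lambda>x. linear_trace (\<lambda>z. (br (A x) ^^ k) (br (B x) z))) has_derivative
    (\<lambda>v. linear_trace (\<lambda>z. (br (A x) ^^ k) (br (B' v) z) + ad_pow_deriv k (A x) (A' v) (br (B x) z)))) (at x)"
    by (intro has_derivative_linear_trace has_derivative_br_power[OF A]
        bounded_linear.has_derivative[OF br.bounded_linear_left B])
  moreover have "linear_trace (\<lambda>z. ad_pow_deriv k a c (br b z)) = linear_trace (\<lambda>z. ad_pow_deriv k a b (br c z))"
    for a b c :: 'g
  proof -
    have t: "linear_trace (\<lambda>z. (br a ^^ j) (br c ((br a ^^ i) (br b z)))) =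
      linear_trace (\<lambda>z. (br a ^^ i) (br b ((br a ^^ j) (br c z))))" for i j
      using linear_trace_commute[OF linear_compose[OF linear_br[of c] linear_br_power[of j a]]
        linear_compose[OF linear_br[of b] linear_br_power[of i a]]]
      by (simp add: comp_def)
    show ?thesis
      \<comment> \<open>the cyclic shift exchanges the powers \<open>j\<close> and \<open>k - 1 - j\<close>, so the sum is reversed\<close>
      unfolding ad_pow_deriv_def linear_trace_sum t
      by (subst sum.nat_diff_reindex[symmetric]) (auto intro!: sum.cong)
  qed
  ultimately show ?thesis by (simp add: linear_trace_add)
qed

lemma has_derivative_trace_power:
  assumes A: "(A has_derivative A') (at x)"
  shows "((\<lambda>x. linear_trace (br (A x) ^^ Suc k) / real (Suc k)) has_derivative
    (\<lambda>v. linear_trace (\<lambda>z. (br (A x) ^^ k) (br (A' v) z)))) (at x)"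
proof -
  have t: "linear_trace (ad_pow_deriv (Suc k) a b) = real (Suc k) * linear_trace (\<lambda>z. (br a ^^ k) (br b z))"
    for a b :: 'g
  proof -
    have "linear_trace (\<lambda>z. (br a ^^ j) (br b ((br a ^^ (k - j)) z))) = linear_trace (\<lambda>z. (br a ^^ k) (br b z))"
      if "j \<le> k" for j
      using linear_trace_commute[OF linear_compose[OF linear_br[of b] linear_br_power[of j a]]
        linear_br_power[of "k - j" a]] funpow_add[of "k - j" j "br a"] that
      by (simp add: comp_def fun_eq_iff)
    moreover have "ad_pow_deriv (Suc k) a b = (\<lambda>z. \<Sum>j<Suc k. (br a ^^ j) (br b ((br a ^^ (k - j)) z)))"
      by (simp add: ad_pow_deriv_def fun_eq_iff)
    ultimately show ?thesis by (simp only: linear_trace_sum) simp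
  qed
  have "((\<lambda>x. linear_trace (\<lambda>z. (br (A x) ^^ Suc k) z)) has_derivative
     (\<lambda>v. linear_trace (\<lambda>z. (br (A x) ^^ Suc k) 0 + ad_pow_deriv (Suc k) (A x) (A' v) z))) (at x)"
    by (intro has_derivative_linear_trace has_derivative_br_power[OF A] has_derivative_const)
  then have "((\<lambda>x. linear_trace (br (A x) ^^ Suc k)) has_derivative
     (\<lambda>v. real (Suc k) * linear_trace (\<lambda>z. (br (A x) ^^ k) (br (A' v) z)))) (at x)"
    by (simp only: linear_0[OF linear_br_power] add_0 t)
  from bounded_linear.has_derivative[OF bounded_linear_divide[of "real (Suc k)"] this]
  show ?thesis by simp
qed

end

locale nondegenerate_lie = lie br for br :: "'g::euclidean_space \<Rightarrow> 'g \<Rightarrow> 'g" +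
  assumes nondegenerate: "(\<And>y. K x y = 0) \<Longrightarrow> x = 0"
begin

text \<open>A nondegenerate form on a finite-dimensional space represents every functional: the map that
  sends \<open>t\<close> to the Euclidean representative of \<open>K t\<close> is injective, hence onto.\<close>

lemma represent_functional:
  assumes "linear l"
  obtains t where "\<And>x. K t x = l x"
proof -
  define T where "T t = (\<Sum>b\<in>Basis. K t b *\<^sub>R b)" for t
  have inner_T: "T t \<bullet> x = K t x" for t x
  proof -
    have "K t x = K t (\<Sum>b\<in>Basis. (x \<bullet> b) *\<^sub>R b)" by (simp add: euclidean_representation)
    then show ?thesis
      unfolding T_def inner_sum_left K.sum_right by (simp add: K.scaleR_right inner_commute mult.commute)
  qed
  have "linear T"
    by (rule linearI) (simp_all add: T_def K.add_left K.scaleR_left scaleR_add_left sum.distrib scaleR_sum_right)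
  moreover have "x = 0" if "T x = 0" for x
    using nondegenerate[of x] inner_T[of x] that by simp
  ultimately have "surj T"
    by (intro linear_injective_imp_surjective) (auto simp: linear_injective_0)
  then obtain t where t: "T t = (\<Sum>b\<in>Basis. l b *\<^sub>R b)" by (metis surjD)
  have "K t x = l x" for x
  proof -
    have "l x = (\<Sum>b\<in>Basis. (x \<bullet> b) * l b)"
      by (subst euclidean_representation[of x, symmetric]) (simp add: linear_sum[OF assms] linear_scale[OF assms])
    then show ?thesis
      unfolding inner_T[symmetric] t inner_sum_left by (simp add: inner_commute mult.commute)
  qed
  then show ?thesis by (rule that)
qed

text \<open>The orthogonal projection of an endomorphism to the image of the adjoint representation, with
  respect to the trace form. If \<open>M\<close> comes from the derivative of a trace polynomial, this is the
  gradient of that polynomial with respect to the Killing form.\<close>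

definition gradient :: "('g \<Rightarrow> 'g) \<Rightarrow> 'g" where
  "gradient M = (SOME X. \<forall>y. K X y = linear_trace (\<lambda>z. M (br y z)))"

lemma K_gradient:
  assumes "linear M" shows "K (gradient M) y = linear_trace (\<lambda>z. M (br y z))"
proof -
  have "linear (\<lambda>y. linear_trace (\<lambda>z. M (br y z)))"
    by (rule linearI) (simp_all add: br.add_left br.scaleR_left linear_add[OF assms]
        linear_scale[OF assms] linear_trace_add linear_trace_scaleR)
  then have "\<exists>X. \<forall>y. K X y = linear_trace (\<lambda>z. M (br y z))"
    by (metis represent_functional)
  then show ?thesis unfolding gradient_def by (rule someI2_ex) blast
qed

lemma K_br_gradient:
  assumes "linear M"
  shows "K (br a (gradient M)) y = linear_trace (\<lambda>z. br a (M (br y z)) - M (br a (br y z)))"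
proof -
  have "K (br a (gradient M)) y = - K (gradient M) (br a y)"
    by (subst br_anticommute) (simp add: K.minus_left K_invariant)
  then show ?thesis
    by (simp add: K_gradient[OF assms] trace_ad_bracket[OF assms] linear_trace_diff)
qed

text \<open>The projection to the adjoint representation is equivariant, so the projection of an
  endomorphism that commutes with \<open>ad a\<close> commutes with \<open>a\<close>. The following lemma is the same statement
  for \<open>a + t b\<close> in the Takiff algebra, read off at order \<open>t\<close>.\<close>

lemma br_gradient_power: "br a (gradient (br a ^^ k)) = 0"
  by (rule nondegenerate)
     (simp add: K_br_gradient[OF linear_br_power] linear_trace_def flip: funpow_swap1)

lemma br_gradient_deriv:
  "br a (gradient (ad_pow_deriv k a b)) + br b (gradient (br a ^^ k)) = 0"
proof (rule nondegenerate)
  fix y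
  have "br a (ad_pow_deriv k a b z) + br b ((br a ^^ k) z) = ad_pow_deriv k a b (br a z) + (br a ^^ k) (br b z)" for z
    using ad_pow_deriv_Suc[of k a b z] ad_pow_deriv_Suc'[of k a b z] by simp
  then have "linear_trace (\<lambda>z. (br a (ad_pow_deriv k a b (br y z)) - ad_pow_deriv k a b (br a (br y z))) +
      (br b ((br a ^^ k) (br y z)) - (br a ^^ k) (br b (br y z)))) = 0"
    by (simp add: linear_trace_def algebra_simps)
  then show "K (br a (gradient (ad_pow_deriv k a b)) + br b (gradient (br a ^^ k))) y = 0"
    by (simp add: K.add_left K_br_gradient linear_br_power linear_ad_pow_deriv linear_trace_add)
qed

end

section \<open>Weight vectors\<close>

text \<open>Applying \<open>T - m\<close> to the sum removes the summand of eigenvalue \<open>m\<close> and rescales the others by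
  nonzero factors.\<close>

lemma eigenvectors_sum_zero:
  fixes T :: "'a::real_vector \<Rightarrow> 'a"
  assumes "linear T" "finite \<Lambda>" "\<And>l. T (w l) = l *\<^sub>R w l" "(\<Sum>l\<in>\<Lambda>. w l) = 0" "l \<in> \<Lambda>"
  shows "w l = 0"
  using assms(2-5)
proof (induction \<Lambda> arbitrary: w l rule: finite_induct)
  case empty
  then show ?case by simp
next
  case (insert m \<Lambda>)
  have "0 = T (\<Sum>l\<in>insert m \<Lambda>. w l) - m *\<^sub>R (\<Sum>l\<in>insert m \<Lambda>. w l)"
    by (simp add: insert.prems linear_0[OF assms(1)])
  also have "\<dots> = (\<Sum>l\<in>\<Lambda>. (l - m) *\<^sub>R w l)"
    using insert.hyps
    by (simp add: linear_add[OF assms(1)] linear_sum[OF assms(1)] insert.prems(1) scaleR_right_distrib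
        scaleR_sum_right scaleR_left_diff_distrib sum_subtractf)
  finally have "(\<Sum>l\<in>\<Lambda>. (l - m) *\<^sub>R w l) = 0" by simp
  then have "(l - m) *\<^sub>R w l = 0" if "l \<in> \<Lambda>" for l
    using that by (intro insert.IH[of "\<lambda>l. (l - m) *\<^sub>R w l"]) (auto simp: linear_scale[OF assms(1)] insert.prems)
  then have z: "w l = 0" if "l \<in> \<Lambda>" for l
    using that insert.hyps by (metis eq_iff_diff_eq_0 scaleR_eq_0_iff)
  then have "w m = 0" using insert.prems(2) insert.hyps by simp
  with z insert.prems(3) show ?case by auto
qed

lemma eigenvector_decomposition:
  fixes T :: "'a::real_vector \<Rightarrow> 'a"
  assumes T: "linear T" and "v \<in> span {v. \<exists>r. T v = r *\<^sub>R v}"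
  obtains \<Lambda> w where "finite \<Lambda>" "\<And>l. T (w l) = l *\<^sub>R w l" "v = (\<Sum>l\<in>\<Lambda>. w l)"
proof -
  let ?P = "\<lambda>v. \<exists>\<Lambda> w. finite \<Lambda> \<and> (\<forall>l. T (w l) = l *\<^sub>R w l) \<and> (\<forall>l. l \<notin> \<Lambda> \<longrightarrow> w l = 0) \<and> v = (\<Sum>l\<in>\<Lambda>. w l)"
  have "subspace {v. ?P v}"
    unfolding subspace_def mem_Collect_eq
  proof (intro conjI allI impI ballI)
    show "?P 0" by (intro exI[of _ "{}"] exI[of _ "\<lambda>_. 0"]) (simp add: linear_0[OF T])
  next
    fix x y assume "x \<in> {v. ?P v}" "y \<in> {v. ?P v}"
    then obtain \<Lambda> w M u where *: "finite \<Lambda>" "\<forall>l. T (w l) = l *\<^sub>R w l" "\<forall>l. l \<notin> \<Lambda> \<longrightarrow> w l = 0" "x = (\<Sum>l\<in>\<Lambda>. w l)"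
      "finite M" "\<forall>l. T (u l) = l *\<^sub>R u l" "\<forall>l. l \<notin> M \<longrightarrow> u l = 0" "y = (\<Sum>l\<in>M. u l)" by blast
    have "x = (\<Sum>l\<in>\<Lambda> \<union> M. w l)" "y = (\<Sum>l\<in>\<Lambda> \<union> M. u l)"
      using * by (auto intro!: sum.mono_neutral_left)
    then have "x + y = (\<Sum>l\<in>\<Lambda> \<union> M. w l + u l)" by (simp add: sum.distrib)
    with * show "?P (x + y)"
      by (intro exI[of _ "\<Lambda> \<union> M"] exI[of _ "\<lambda>l. w l + u l"])
         (auto simp: linear_add[OF T] scaleR_add_right)
  next
    fix c x assume "x \<in> {v. ?P v}"
    then obtain \<Lambda> w where *: "finite \<Lambda>" "\<forall>l. T (w l) = l *\<^sub>R w l" "\<forall>l. l \<notin> \<Lambda> \<longrightarrow> w l = 0" "x = (\<Sum>l\<in>\<Lambda>. w l)"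
      by blast
    then show "?P (c *\<^sub>R x)"
      by (intro exI[of _ \<Lambda>] exI[of _ "\<lambda>l. c *\<^sub>R w l"]) (auto simp: linear_scale[OF T] scaleR_sum_right)
  qed
  moreover have "{v. \<exists>r. T v = r *\<^sub>R v} \<subseteq> {v. ?P v}"
  proof clarify
    fix v r assume "T v = r *\<^sub>R v"
    then show "?P v"
      by (intro exI[of _ "{r}"] exI[of _ "\<lambda>l. if l = r then v else 0"]) (simp add: linear_0[OF T])
  qed
  ultimately have "?P v" using assms(2) span_minimal by blast
  then show ?thesis using that by blast
qed

locale split_lie = nondegenerate_lie br for br :: "'g::euclidean_space \<Rightarrow> 'g \<Rightarrow> 'g" +
  fixes \<hh> :: "'g set"
  assumes split: "split_cartan_subalgebra br \<hh>"
begin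

lemma subspace_cartan: "subspace \<hh>"
  and cartan_eq: "\<hh> = {x. \<forall>y\<in>\<hh>. br x y = 0}"
  and diagonalizable: "x \<in> \<hh> \<Longrightarrow> span {v. \<exists>r. br x v = r *\<^sub>R v} = UNIV"
  using split by (auto simp: split_cartan_subalgebra_def)

lemma abelian: "x \<in> \<hh> \<Longrightarrow> y \<in> \<hh> \<Longrightarrow> br x y = 0"
  using cartan_eq by blast

definition weight_vector :: "'g \<Rightarrow> bool" where
  "weight_vector v \<longleftrightarrow> (\<forall>x\<in>\<hh>. \<exists>r. br x v = r *\<^sub>R v)"

text \<open>The eigenvalue of \<open>ad x\<close> on \<open>v\<close>. As a Rayleigh quotient it is linear in \<open>x\<close> on the whole
  space, also where \<open>v\<close> is not an eigenvector.\<close>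

definition weight :: "'g \<Rightarrow> 'g \<Rightarrow> real" where
  "weight v x = (br x v \<bullet> v) / (v \<bullet> v)"

lemma linear_weight: "linear (weight v)"
  by (rule linearI) (simp_all add: weight_def br.add_left br.scaleR_left inner_add_left add_divide_distrib)

lemma br_weight: "weight_vector v \<Longrightarrow> x \<in> \<hh> \<Longrightarrow> br x v = weight v x *\<^sub>R v"
  by (cases "v = 0") (auto simp: weight_vector_def weight_def)

lemma weight_unique: "br x v = r *\<^sub>R v \<Longrightarrow> v \<noteq> 0 \<Longrightarrow> weight v x = r"
  by (simp add: weight_def)

text \<open>Commuting diagonalizable operators are simultaneously diagonalizable. The induction step takes a
  joint eigenvector \<open>v\<close> of the operators treated so far and splits it into eigenvectors of the next
  operator \<open>ad y\<close>. The components are again joint eigenvectors, because the eigenspaces of \<open>ad y\<close>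
  are invariant and independent. By linearity a basis of the Cartan subalgebra is enough.\<close>

lemma span_weight_vectors: "span {v. weight_vector v} = UNIV"
proof -
  have fin: "span {v. \<forall>x\<in>B. \<exists>r. br x v = r *\<^sub>R v} = UNIV" if "finite B" "B \<subseteq> \<hh>" for B
    using that
  proof (induction B rule: finite_induct)
    case empty
    then show ?case by simp
  next
    case (insert y B)
    have "{v. \<forall>x\<in>B. \<exists>r. br x v = r *\<^sub>R v} \<subseteq> span {v. \<forall>x\<in>insert y B. \<exists>r. br x v = r *\<^sub>R v}"
    proof clarify
      fix v assume v: "\<forall>x\<in>B. \<exists>r. br x v = r *\<^sub>R v"
      obtain \<Lambda> w where w: "finite \<Lambda>" "\<And>l. br y (w l) = l *\<^sub>R w l" "v = (\<Sum>l\<in>\<Lambda>. w l)"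
        using eigenvector_decomposition[OF linear_br[of y], of v] diagonalizable[of y] insert.prems by auto
      have "w l \<in> {v. \<forall>x\<in>insert y B. \<exists>r. br x v = r *\<^sub>R v}" if "l \<in> \<Lambda>" for l
      proof clarify
        fix x assume "x \<in> insert y B"
        then show "\<exists>r. br x (w l) = r *\<^sub>R w l"
        proof
          assume "x = y" then show ?thesis using w(2) by blast
        next
          assume x: "x \<in> B"
          with v obtain r where r: "br x v = r *\<^sub>R v" by blast
          have "br y (br x (w l)) = br x (br y (w l))" for l
            using jacobi[of y x "w l"] abelian[of y x] insert.prems x by (auto simp: br.zero_left)
          then have "br x (w l) - r *\<^sub>R w l = 0"
            using r that
            by (intro eigenvectors_sum_zero[OF linear_br[of y] w(1), of "\<lambda>l. br x (w l) - r *\<^sub>R w l"])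
               (auto simp: w br.diff_right br.scaleR_right br.sum_right sum_subtractf scaleR_sum_right
                  scaleR_right_diff_distrib mult.commute)
          then show ?thesis by auto
        qed
      qed
      then show "v \<in> span {v. \<forall>x\<in>insert y B. \<exists>r. br x v = r *\<^sub>R v}"
        unfolding w(3) by (intro span_sum span_base)
    qed
    from span_minimal[OF this subspace_span] show ?case using insert by auto
  qed
  obtain B where B: "B \<subseteq> \<hh>" "independent B" "\<hh> \<subseteq> span B" using basis_exists[of \<hh>] by metis
  have "{v. \<forall>x\<in>B. \<exists>r. br x v = r *\<^sub>R v} \<subseteq> {v. weight_vector v}"
  proof clarify
    fix v assume v: "\<forall>x\<in>B. \<exists>r. br x v = r *\<^sub>R v"
    have "subspace {x. \<exists>r. br x v = r *\<^sub>R v}"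
      unfolding subspace_def
      by (auto simp: br.zero_left br.add_left br.scaleR_left intro: exI[of _ 0] simp flip: scaleR_add_left)
    with v have "span B \<subseteq> {x. \<exists>r. br x v = r *\<^sub>R v}" by (intro span_minimal) auto
    with B(3) show "weight_vector v" by (auto simp: weight_vector_def)
  qed
  from span_mono[OF this] fin[OF finiteI_independent[OF B(2)] B(1)] show ?thesis by auto
qed

lemma weight_vector_cartan: "v \<in> \<hh> \<Longrightarrow> weight_vector v"
  by (auto simp: weight_vector_def abelian intro: exI[of _ 0])

lemma weight_vector_root:
  assumes "weight_vector v" "v \<notin> \<hh>" shows "is_root br \<hh> (weight v)"
proof -
  have "v \<noteq> 0" using assms(2) subspace_0[OF subspace_cartan] by auto
  moreover have "\<exists>x\<in>\<hh>. weight v x \<noteq> 0"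
  proof (rule ccontr)
    assume "\<not> ?thesis"
    then have "br v x = 0" if "x \<in> \<hh>" for x
      using br_weight[OF assms(1) that] that by (subst br_anticommute) simp
    then show False using assms(2) cartan_eq by blast
  qed
  ultimately show ?thesis using br_weight[OF assms(1)] by (auto simp: is_root_def)
qed

text \<open>Eigenspaces of \<open>ad x\<close> with eigenvalues that are not opposite are orthogonal, because \<open>ad x\<close> is
  skew for the Killing form.\<close>

lemma K_eigenvectors:
  assumes "br x v = a *\<^sub>R v" "br x w = b *\<^sub>R w" "a + b \<noteq> 0"
  shows "K v w = 0"
proof -
  have "a * K v w = K (br x v) w" by (simp add: assms(1) K.scaleR_left)
  also have "\<dots> = - K v (br x w)"
    by (subst br_anticommute) (simp add: K.minus_left K_invariant)
  also have "\<dots> = - b * K v w" by (simp add: assms(2) K.scaleR_right)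
  finally have "(a + b) * K v w = 0" by (simp add: algebra_simps)
  with assms(3) show ?thesis by simp
qed

lemma cartan_decomposition:
  obtains x y where "x \<in> \<hh>" "y \<in> span {v. weight_vector v \<and> v \<notin> \<hh>}" "z = x + y"
proof -
  have "{v. weight_vector v} = \<hh> \<union> {v. weight_vector v \<and> v \<notin> \<hh>}" using weight_vector_cartan by auto
  then have "z \<in> span (\<hh> \<union> {v. weight_vector v \<and> v \<notin> \<hh>})" using span_weight_vectors by auto
  then show ?thesis
    unfolding span_Un using that span_eq_iff[THEN iffD2, OF subspace_cartan] by auto
qed

lemma K_cartan_root_space:
  assumes "x \<in> \<hh>" "y \<in> span {v. weight_vector v \<and> v \<notin> \<hh>}"
  shows "K x y = 0"
proof -
  have "K x v = 0" if v: "weight_vector v" "v \<notin> \<hh>" for v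
  proof -
    obtain u where "u \<in> \<hh>" "weight v u \<noteq> 0" using weight_vector_root[OF v] by (auto simp: is_root_def)
    then show ?thesis
      using K_eigenvectors[of u x 0 v "weight v u"] abelian[OF _ assms(1)] br_weight[OF v(1)] by auto
  qed
  moreover have "subspace {v. K x v = 0}"
    by (auto simp: subspace_def K.zero_right K.add_right K.scaleR_right)
  ultimately have "span {v. weight_vector v \<and> v \<notin> \<hh>} \<subseteq> {v. K x v = 0}"
    by (intro span_minimal) auto
  with assms(2) show ?thesis by auto
qed

lemma nondegenerate_on_cartan:
  assumes "x \<in> \<hh>" "\<And>y. y \<in> \<hh> \<Longrightarrow> K x y = 0" shows "x = 0"
proof (rule nondegenerate)
  fix z
  obtain u y where "u \<in> \<hh>" "y \<in> span {v. weight_vector v \<and> v \<notin> \<hh>}" "z = u + y"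
    by (rule cartan_decomposition)
  then show "K x z = 0" using assms K_cartan_root_space by (simp add: K.add_right)
qed

text \<open>The root spaces are orthogonal to the Cartan subalgebra, so the Cartan component of a
  representative on the whole algebra still represents the functional there.\<close>

lemma represent_functional_on_cartan:
  assumes "linear l"
  obtains t where "t \<in> \<hh>" "\<And>x. x \<in> \<hh> \<Longrightarrow> K t x = l x"
proof -
  obtain s where s: "\<And>x. K s x = l x" by (metis represent_functional[OF assms])
  obtain u y where "u \<in> \<hh>" "y \<in> span {v. weight_vector v \<and> v \<notin> \<hh>}" "s = u + y"
    by (rule cartan_decomposition)
  then have "K u x = l x" if "x \<in> \<hh>" for x
    using s[of x] K_cartan_root_space[OF that] by (simp add: K.add_left K_commute[of y x])
  with \<open>u \<in> \<hh>\<close> show ?thesis using that by blast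
qed

end

section \<open>Simple roots\<close>

text \<open>Here \<open>r\<close> times the Killing form is the normalized form \<open>\<kappa>\<close>. The element \<open>d\<close>, on which all
  simple roots take the value \<open>1\<close>, grades the algebra by the height of roots.\<close>

locale toda_frame = split_lie br \<hh> for br :: "'g::euclidean_space \<Rightarrow> 'g \<Rightarrow> 'g" and \<hh> +
  fixes \<alpha> :: "'n::finite \<Rightarrow> 'g \<Rightarrow> real" and r :: real and h e f :: "'n \<Rightarrow> 'g" and d :: 'g
  assumes simple: "simple_roots br \<hh> \<alpha>"
    and r_nonzero: "r \<noteq> 0"
    and h_cartan: "h i \<in> \<hh>"
    and K_h: "x \<in> \<hh> \<Longrightarrow> r * K (h i) x = \<alpha> i x"
    and br_e: "x \<in> \<hh> \<Longrightarrow> br x (e i) = \<alpha> i x *\<^sub>R e i"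
    and br_f: "x \<in> \<hh> \<Longrightarrow> br x (f i) = - \<alpha> i x *\<^sub>R f i"
    and K_e_f: "r * K (e i) (f j) = (if i = j then 1 else 0)"
    and d_cartan: "d \<in> \<hh>"
    and height_simple: "\<alpha> i d = 1"

context split_lie
begin

text \<open>By nondegeneracy some weight vector pairs nontrivially with \<open>e i\<close>; its weight must then be
  \<open>- \<alpha> i\<close>, so a multiple of it can serve as \<open>f i\<close>. Because the simple roots are linearly independent,
  so are the \<open>h i\<close>, and there is a functional with the value \<open>1 / r\<close> at each of them; it is represented
  by \<open>d\<close>.\<close>

lemma exists_toda_frame:
  fixes \<alpha> :: "'n::finite \<Rightarrow> 'g \<Rightarrow> real"
  assumes simple: "simple_roots br \<hh> \<alpha>" and r: "r \<noteq> 0"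
    and h: "\<And>i. h i \<in> \<hh>" "\<And>i x. x \<in> \<hh> \<Longrightarrow> r * K (h i) x = \<alpha> i x"
  obtains e f d where "toda_frame br \<hh> \<alpha> r h e f d"
proof -
  have indep: "a i = 0" if "\<And>x. x \<in> \<hh> \<Longrightarrow> (\<Sum>i\<in>UNIV. a i * \<alpha> i x) = 0" for a i
    using simple that by (auto simp: simple_roots_def)
  have "\<exists>v. v \<noteq> 0 \<and> (\<forall>x\<in>\<hh>. br x v = \<alpha> i x *\<^sub>R v)" for i
    using simple by (auto simp: simple_roots_def is_root_def)
  then obtain e where e: "\<And>i. e i \<noteq> 0" "\<And>i x. x \<in> \<hh> \<Longrightarrow> br x (e i) = \<alpha> i x *\<^sub>R e i" by metis
  have "\<exists>w. r * K (e i) w = 1 \<and> (\<forall>x\<in>\<hh>. br x w = - \<alpha> i x *\<^sub>R w)" for i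
  proof -
    have "\<exists>w. weight_vector w \<and> K (e i) w \<noteq> 0"
    proof (rule ccontr)
      assume "\<not> ?thesis"
      moreover have "subspace {w. K (e i) w = 0}"
        by (auto simp: subspace_def K.zero_right K.add_right K.scaleR_right)
      ultimately have "span {v. weight_vector v} \<subseteq> {w. K (e i) w = 0}" by (intro span_minimal) auto
      with nondegenerate[of "e i"] e(1) span_weight_vectors show False by auto
    qed
    then obtain w where w: "weight_vector w" "K (e i) w \<noteq> 0" by blast
    have "weight w x = - \<alpha> i x" if "x \<in> \<hh>" for x
      using K_eigenvectors[OF e(2)[OF that] br_weight[OF w(1) that]] w(2) by force
    then show ?thesis
      using w r br_weight[OF w(1)]
      by (intro exI[of _ "(1 / (r * K (e i) w)) *\<^sub>R w"]) (auto simp: K.scaleR_right br.scaleR_right)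
  qed
  then obtain f where f: "\<And>i. r * K (e i) (f i) = 1" "\<And>i x. x \<in> \<hh> \<Longrightarrow> br x (f i) = - \<alpha> i x *\<^sub>R f i"
    by metis
  have "K (e i) (f j) = 0" if "i \<noteq> j" for i j
  proof (rule ccontr)
    assume "K (e i) (f j) \<noteq> 0"
    then have "\<alpha> i x - \<alpha> j x = 0" if "x \<in> \<hh>" for x
      using K_eigenvectors[OF e(2)[OF that] f(2)[OF that]] by force
    then have "(\<Sum>k\<in>UNIV. ((if k = i then 1 else 0) - (if k = j then 1 else 0)) * \<alpha> k x) = 0" if "x \<in> \<hh>" for x
      using that by (simp add: left_diff_distrib sum_subtractf if_distrib[of "\<lambda>c. c * _"] cong: if_cong)
    from indep[OF this, of i] that show False by simp
  qed
  then have ef: "r * K (e i) (f j) = (if i = j then 1 else 0)" for i j using f(1) by simp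
  have "inj h"
  proof (rule injI, rule ccontr)
    fix i j assume "h i = h j" "i \<noteq> j"
    then have "\<alpha> i x - \<alpha> j x = 0" if "x \<in> \<hh>" for x
      using h(2)[OF that, of i] h(2)[OF that, of j] by simp
    then have "(\<Sum>k\<in>UNIV. ((if k = i then 1 else 0) - (if k = j then 1 else 0)) * \<alpha> k x) = 0" if "x \<in> \<hh>" for x
      using that by (simp add: left_diff_distrib sum_subtractf if_distrib[of "\<lambda>c. c * _"] cong: if_cong)
    from indep[OF this, of i] \<open>i \<noteq> j\<close> show False by simp
  qed
  have "independent (range h)"
  proof (subst independent_explicit, intro conjI allI impI ballI)
    fix u v assume u: "(\<Sum>v\<in>range h. u v *\<^sub>R v) = 0" and "v \<in> range h"
    have "(\<Sum>i\<in>UNIV. u (h i) * \<alpha> i x) = 0" if "x \<in> \<hh>" for x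
    proof -
      have "(\<Sum>i\<in>UNIV. u (h i) *\<^sub>R h i) = 0" using u by (simp add: sum.reindex[OF \<open>inj h\<close>])
      then have "r * K (\<Sum>i\<in>UNIV. u (h i) *\<^sub>R h i) x = 0" by (simp add: K.zero_left)
      then show ?thesis
        by (simp add: K.sum_left K.scaleR_left sum_distrib_left mult.left_commute flip: h(2)[OF that])
    qed
    from indep[OF this] \<open>v \<in> range h\<close> show "u v = 0" by auto
  qed simp
  then obtain l where l: "linear l" "\<And>i. l (h i) = 1 / r"
    using linear_independent_extend[of "range h" "\<lambda>_. 1 / r"] by auto
  then obtain d where d: "d \<in> \<hh>" "\<And>x. x \<in> \<hh> \<Longrightarrow> K d x = l x"
    by (metis represent_functional_on_cartan)
  have "\<alpha> i d = 1" for i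
    using h(2)[OF d(1), of i] d(2)[OF h(1), of i] l(2) r by (simp add: K_commute)
  then show ?thesis
    by (intro that[of e f d], unfold_locales) (use simple r h e(2) f(2) ef d(1) in auto)
qed

end

context toda_frame
begin

lemma root_combination:
  assumes "weight_vector v" "v \<notin> \<hh>"
  obtains k :: "'n \<Rightarrow> nat" and s :: real where "s = 1 \<or> s = -1"
    "\<And>x. x \<in> \<hh> \<Longrightarrow> weight v x = s * (\<Sum>i\<in>UNIV. real (k i) * \<alpha> i x)"
proof -
  obtain k :: "'n \<Rightarrow> nat" where
    "(\<forall>x\<in>\<hh>. weight v x = (\<Sum>i\<in>UNIV. real (k i) * \<alpha> i x)) \<or>
     (\<forall>x\<in>\<hh>. weight v x = - (\<Sum>i\<in>UNIV. real (k i) * \<alpha> i x))"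
    using simple weight_vector_root[OF assms] unfolding simple_roots_def by blast
  then show ?thesis using that[of 1 k] that[of "-1" k] by auto
qed

text \<open>An element on which the simple roots vanish is annihilated by all roots, hence central, hence in the radical of the Killing
  form.\<close>

lemma simple_roots_zero_imp_zero:
  assumes "w \<in> \<hh>" "\<And>i. \<alpha> i w = 0" shows "w = 0"
proof (rule nondegenerate)
  fix y
  have "br w v = 0" if "weight_vector v" for v
  proof (cases "v \<in> \<hh>")
    case True
    then show ?thesis using abelian assms(1) by blast
  next
    case False
    then obtain k s where "\<And>x. x \<in> \<hh> \<Longrightarrow> weight v x = s * (\<Sum>i\<in>UNIV. real (k i :: nat) * \<alpha> i x)"
      by (metis root_combination[OF \<open>weight_vector v\<close>])
    then show ?thesis using br_weight[OF that assms(1)] assms by simp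
  qed
  then have "br w v = (\<lambda>_. 0) v" for v
    using linear_eq_on_span[OF linear_br[of w] linear_zero, of "{v. weight_vector v}"] span_weight_vectors by auto
  then show "K w y = 0" by (simp add: K_eq_trace linear_trace_def)
qed

lemma gram_nonsingular:
  assumes "\<And>j. K (\<Sum>i\<in>UNIV. a i *\<^sub>R h i) (h j) = 0" shows "a i = 0"
proof -
  let ?w = "\<Sum>i\<in>UNIV. a i *\<^sub>R h i"
  have w: "?w \<in> \<hh>"
    by (intro subspace_sum subspace_scale subspace_cartan h_cartan)
  have "\<alpha> j ?w = 0" for j
    using K_h[OF w, of j] assms[of j] by (simp add: K_commute)
  from simple_roots_zero_imp_zero[OF w this] have "?w = 0" .
  then have "r * K ?w x = 0" for x by (simp add: K.zero_left)
  then have "(\<Sum>i\<in>UNIV. a i * \<alpha> i x) = 0" if "x \<in> \<hh>" for x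
    by (simp add: K.sum_left K.scaleR_left sum_distrib_left mult.left_commute flip: K_h[OF that])
  then show ?thesis using simple by (auto simp: simple_roots_def)
qed

end

section \<open>Trace polynomials separating the Cartan subalgebra\<close>

lemma exists_nonorthogonal:
  fixes S :: "'a::euclidean_space set"
  assumes "finite S" "0 \<notin> S"
  obtains x where "\<And>u. u \<in> S \<Longrightarrow> u \<bullet> x \<noteq> 0"
proof -
  have "negligible (\<Union>u\<in>S. {x. u \<bullet> x = 0})"
    using assms by (intro negligible_Union) (auto intro!: negligible_hyperplane)
  then have "(\<Union>u\<in>S. {x. u \<bullet> x = 0}) \<noteq> UNIV" using non_negligible_UNIV by metis
  then show ?thesis using that by blast
qed

text \<open>In the step from \<open>X\<close> to \<open>X \<union> {a}\<close> a multiple of the polynomial with zeros \<open>X\<close> corrects the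
  value at \<open>a\<close>.\<close>

lemma exists_interpolation_polynomial:
  fixes g :: "real \<Rightarrow> real"
  assumes "finite X"
  shows "\<exists>p :: real poly. \<forall>x\<in>X. poly p x = g x"
  using assms
proof (induction X rule: finite_induct)
  case empty
  then show ?case by simp
next
  case (insert a X)
  then obtain p where p: "\<forall>x\<in>X. poly p x = g x" by blast
  define q where "q = (\<Prod>x\<in>X. [:- x, 1:])"
  have q: "poly q y = (\<Prod>x\<in>X. y - x)" for y by (simp add: q_def poly_prod)
  then have "poly q x = 0" if "x \<in> X" for x using that insert.hyps by (auto intro!: prod_zero)
  moreover have "poly q a \<noteq> 0" using insert.hyps by (auto simp: q)
  ultimately show ?case
    using p by (intro exI[of _ "p + smult ((g a - poly p a) / poly q a) q"]) auto
qed

lemma orthogonal_trivial_imp_span: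
  fixes S :: "'a::euclidean_space set"
  assumes "\<And>a. (\<And>v. v \<in> S \<Longrightarrow> v \<bullet> a = 0) \<Longrightarrow> a = 0"
  shows "span S = UNIV"
proof (rule ccontr)
  assume "span S \<noteq> UNIV"
  then have "dim S < DIM('a)"
    using dim_eq_full[of S] dim_subset_UNIV[of S] by linarith
  then obtain x where "x \<noteq> 0" "\<And>y. y \<in> span S \<Longrightarrow> orthogonal x y"
    using orthogonal_to_subspace_exists[of S] by blast
  with assms[of x] show False by (auto simp: orthogonal_def inner_commute span_base)
qed

text \<open>A linearly independent family with one prescribed member is extended to a basis within the
  spanning family. The prescribed member is needed later to have the Hamiltonian among the
  integrals.\<close>

lemma choose_nonsingular_rows:
  fixes V :: "'b \<Rightarrow> real ^ 'n::finite"
  assumes "span (range V) = UNIV" "V k0 \<noteq> 0"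
  obtains k :: "'n \<Rightarrow> 'b" and i0 where "k i0 = k0" "det (\<chi> i. V (k i)) \<noteq> 0"
proof -
  have "independent {V k0}" using assms(2) by simp
  then obtain C where C: "{V k0} \<subseteq> C" "C \<subseteq> range V" "independent C" "range V \<subseteq> span C"
    using maximal_independent_subset_extend[of "{V k0}" "range V"] by auto
  have span: "span C = UNIV" using C(4) assms(1) span_minimal[of "range V" "span C"] by auto
  then have "card C = CARD('n)" using basis_card_eq_dim[of C UNIV] C(3) by simp
  moreover have "finite C" using C(3) by (rule finiteI_independent)
  ultimately obtain g where g: "bij_betw g (UNIV :: 'n set) C"
    using finite_same_card_bij[of "UNIV :: 'n set" C] by auto
  have "\<exists>k. V k = g i \<and> (g i = V k0 \<longrightarrow> k = k0)" for i
  proof -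
    have "g i \<in> range V" using bij_betwE[OF g] C(2) by blast
    then show ?thesis by (cases "g i = V k0") auto
  qed
  then obtain k where k: "\<And>i. V (k i) = g i" "\<And>i. g i = V k0 \<Longrightarrow> k i = k0" by metis
  obtain i0 where "g i0 = V k0" using g C(1) by (auto simp: bij_betw_def)
  moreover have "det (\<chi> i. V (k i)) \<noteq> 0"
  proof -
    have "a = 0" if a: "(\<chi> i. V (k i)) *v a = 0" for a
    proof -
      have "g i \<bullet> a = 0" for i
        using arg_cong[OF a, of "\<lambda>w. w $ i"] by (simp add: matrix_vector_mul_component k)
      then have "c \<bullet> a = 0" if "c \<in> C" for c using that g by (auto simp: bij_betw_def)
      then have "span C \<subseteq> {c. c \<bullet> a = 0}"
        by (intro span_minimal) (auto simp: subspace_def inner_simps)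
      then have "a \<in> {c. c \<bullet> a = 0}" using span by blast
      then show "a = 0" by simp
    qed
    then show ?thesis
      by (metis invertible_det_nz invertible_left_inverse matrix_left_invertible_ker)
  qed
  ultimately show ?thesis using k that by blast
qed

context toda_frame
begin

text \<open>Up to the factor \<open>r\<close>, the derivatives of the \<open>tr (ad a ^ (k m + 1)) / (k m + 1)\<close> along the
  \<open>h i\<close>.\<close>

definition jacobian :: "('n \<Rightarrow> nat) \<Rightarrow> 'g \<Rightarrow> real ^ 'n ^ 'n" where
  "jacobian k a = (\<chi> m i. linear_trace (\<lambda>z. (br a ^^ k m) (br (h i) z)))"

text \<open>The element \<open>x = \<Sum> \<rho> i h i\<close> is chosen to separate any two weights that differ on some
  \<open>h i\<close>. For every combination \<open>y\<close> of the \<open>h i\<close> the eigenvalues of \<open>ad y\<close> are then a function of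
  those of \<open>ad x\<close>, and interpolating this function expresses \<open>ad y\<close> as a polynomial in \<open>ad x\<close>. If
  \<open>w\<close>, another such combination, satisfies \<open>tr (ad x ^ k ad w) = 0\<close> for all \<open>k\<close>, then \<open>w\<close> is
  orthogonal to every \<open>y\<close> and vanishes, as the Gram matrix is nonsingular. So the vectors \<open>V k\<close>
  of these traces span.\<close>

lemma exists_nonsingular_jacobian:
  obtains \<rho> :: "real ^ 'n" and k i0 where "k i0 = 1" "det (jacobian k (\<Sum>i\<in>UNIV. \<rho> $ i *\<^sub>R h i)) \<noteq> 0"
proof -
  obtain B where B: "B \<subseteq> {v. weight_vector v}" "independent B" "{v. weight_vector v} \<subseteq> span B"
    using basis_exists[of "{v. weight_vector v}"] by metis
  have finB: "finite B" using B(2) by (rule finiteI_independent)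
  have spanB: "span B = UNIV"
    using span_minimal[OF B(3) subspace_span] span_weight_vectors by auto
  define u where "u v v' = (\<chi> i. weight v (h i) - weight v' (h i))" for v v'
  \<comment> \<open>the additional vector only ensures that \<open>\<rho>\<close>, and with it \<open>x\<close>, is not zero\<close>
  define S where "S = insert (axis (SOME i. True) 1) ((\<lambda>(v, v'). u v v') ` (B \<times> B) - {0 :: real ^ 'n})"
  obtain \<rho> where \<rho>: "\<And>w. w \<in> S \<Longrightarrow> w \<bullet> \<rho> \<noteq> 0"
    using exists_nonorthogonal[of S] finB by (auto simp: S_def axis_eq_0_iff)
  define comb where "comb a = (\<Sum>i\<in>UNIV. (a :: real ^ 'n) $ i *\<^sub>R h i)" for a
  have comb_cartan: "comb a \<in> \<hh>" for a
    unfolding comb_def by (intro subspace_sum subspace_scale subspace_cartan h_cartan)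
  define x where "x = comb \<rho>"
  define V where "V k = (\<chi> i. linear_trace (\<lambda>z. (br x ^^ k) (br (h i) z)))" for k
  have V: "V k \<bullet> a = linear_trace (\<lambda>z. (br x ^^ k) (br (comb a) z))" for k a
    by (simp add: V_def comb_def inner_vec_def br.sum_left br.scaleR_left linear_sum[OF linear_br_power]
        linear_scale[OF linear_br_power] linear_trace_sum linear_trace_scaleR mult.commute)
  have weight_comb: "weight v (comb a) = (\<Sum>i\<in>UNIV. a $ i * weight v (h i))" for v a
    by (simp add: comb_def linear_sum[OF linear_weight] linear_scale[OF linear_weight])
  have generic: "weight v (comb a) = weight v' (comb a)"
    if "v \<in> B" "v' \<in> B" "weight v x = weight v' x" for v v' a
  proof -
    have "u v v' \<bullet> \<rho> = weight v x - weight v' x"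
      by (simp add: u_def inner_vec_def x_def weight_comb right_diff_distrib sum_subtractf mult.commute)
    then have "u v v' \<notin> S" using \<rho>[of "u v v'"] that by auto
    then have "u v v' = 0" using that by (auto simp: S_def)
    then have "weight v (h i) = weight v' (h i)" for i by (simp add: u_def vec_eq_iff)
    then show ?thesis by (simp add: weight_comb)
  qed
  have "a = 0" if a: "\<And>k. V k \<bullet> a = 0" for a
  proof -
    have "K (comb a) (comb b) = 0" for b
    proof -
      obtain p :: "real poly" where p: "\<And>v. v \<in> B \<Longrightarrow> poly p (weight v x) = weight v (comb b)"
      proof -
        define g where "g t = weight (SOME v. v \<in> B \<and> weight v x = t) (comb b)" for t
        have g: "g (weight v x) = weight v (comb b)" if "v \<in> B" for v
        proof -
          have "(SOME v'. v' \<in> B \<and> weight v' x = weight v x) \<in> B \<and>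
            weight (SOME v'. v' \<in> B \<and> weight v' x = weight v x) x = weight v x"
            using that by (intro someI[where P = "\<lambda>v'. v' \<in> B \<and> weight v' x = weight v x"]) simp
          then show ?thesis unfolding g_def using that by (intro generic) auto
        qed
        obtain p where "\<forall>t\<in>(\<lambda>v. weight v x) ` B. poly p t = g t"
          using exists_interpolation_polynomial[of "(\<lambda>v. weight v x) ` B" g] finB by blast
        then show ?thesis using that g by auto
      qed
      define P where "P z = (\<Sum>k\<le>degree p. coeff p k *\<^sub>R (br x ^^ k) z)" for z
      have linP: "linear P"
        unfolding P_def by (intro linear_compose_sum ballI linear_compose_scale_right linear_br_power)
      have "br (comb b) v = P v" if "v \<in> B" for v
      proof -
        have v: "weight_vector v" using that B(1) by auto
        have "(br x ^^ k) v = (weight v x ^ k) *\<^sub>R v" for k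
          by (induction k) (simp_all add: br.scaleR_right br_weight[OF v] x_def comb_cartan mult.commute)
        then have "P v = poly p (weight v x) *\<^sub>R v"
          by (simp add: P_def poly_altdef scaleR_sum_left)
        then show ?thesis using p[OF that] br_weight[OF v comb_cartan] by simp
      qed
      then have "br (comb b) z = P z" for z
        using linear_eq_on_span[OF linear_br linP, of B] spanB by auto
      then have "K (comb b) (comb a) = (\<Sum>k\<le>degree p. coeff p k * (V k \<bullet> a))"
        by (simp add: K_eq_trace P_def linear_trace_sum linear_trace_scaleR V)
      then show ?thesis using a by (simp add: K_commute)
    qed
    from this[of "axis j 1" for j] have "K (\<Sum>i\<in>UNIV. a $ i *\<^sub>R h i) (h j) = 0" for j
      by (simp add: comb_def axis_def if_distrib[of "\<lambda>c. c *\<^sub>R _"] cong: if_cong)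
    from gram_nonsingular[OF this] show "a = 0" by (simp add: vec_eq_iff)
  qed
  then have span: "span (range V) = UNIV"
    by (intro orthogonal_trivial_imp_span) auto
  \<comment> \<open>the entries of \<open>V 1\<close> are the Killing products of \<open>x\<close> with the \<open>h i\<close>\<close>
  have V1: "V 1 \<noteq> 0"
  proof
    assume "V 1 = 0"
    then have "K (\<Sum>i\<in>UNIV. \<rho> $ i *\<^sub>R h i) (h j) = 0" for j
      by (simp add: V_def vec_eq_iff K_eq_trace x_def comb_def)
    from gram_nonsingular[OF this] have "\<rho> = 0" by (simp add: vec_eq_iff)
    then show False using \<rho>[of "axis (SOME i. True) 1"] by (simp add: S_def)
  qed
  obtain k :: "'n \<Rightarrow> nat" and i0 where "k i0 = 1" "det (\<chi> i. V (k i)) \<noteq> 0"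
    using choose_nonsingular_rows[OF span V1] by blast
  then show ?thesis using that[of k i0 \<rho>] by (simp add: jacobian_def V_def x_def comb_def)
qed

end

section \<open>The triangular decomposition and involution\<close>

context toda_frame
begin

text \<open>The sum of the eigenspaces of \<open>ad d\<close> with eigenvalues in \<open>I\<close>. Since nonzero eigenvalues
  are heights of roots, hence integers, \<open>I = {..-1}\<close> and \<open>I = {1..}\<close> give the lower and the upper
  nilpotent subalgebra.\<close>

definition graded :: "real set \<Rightarrow> 'g set" where
  "graded I = span {v. \<exists>m\<in>I. br d v = m *\<^sub>R v}"

lemma K_graded_eigenvector:
  assumes "br d w = a *\<^sub>R w" "- a \<notin> I" "v \<in> graded I" shows "K w v = 0"
proof -
  have "{v. \<exists>m\<in>I. br d v = m *\<^sub>R v} \<subseteq> {v. K w v = 0}"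
  proof clarify
    fix v m assume m: "m \<in> I" "br d v = m *\<^sub>R v"
    then have "a + m \<noteq> 0" using assms(2) by (metis add.inverse_inverse eq_neg_iff_add_eq_0 neg_eq_iff_add_eq_0)
    with assms(1) m(2) show "K w v = 0" by (rule K_eigenvectors)
  qed
  then have "graded I \<subseteq> {v. K w v = 0}"
    unfolding graded_def by (intro span_minimal) (auto simp: subspace_def K.zero_right K.add_right K.scaleR_right)
  with assms(3) show ?thesis by auto
qed

lemma br_graded:
  assumes "u \<in> graded I" "v \<in> graded J" "\<And>a b. a \<in> I \<Longrightarrow> b \<in> J \<Longrightarrow> a + b \<in> L"
  shows "br u v \<in> graded L"
proof -
  let ?E = "\<lambda>I. {v. \<exists>m\<in>I. br d v = m *\<^sub>R v}"
  have sub: "subspace (graded L)" by (simp add: graded_def)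
  have "br u v \<in> graded L" if "u \<in> ?E I" "v \<in> ?E J" for u v
  proof -
    from that obtain a b where ab: "a \<in> I" "br d u = a *\<^sub>R u" "b \<in> J" "br d v = b *\<^sub>R v" by blast
    have "br d (br u v) = br (br d u) v + br u (br d v)" by (simp add: jacobi)
    also have "\<dots> = (a + b) *\<^sub>R br u v"
      by (simp add: ab br.scaleR_left br.scaleR_right scaleR_add_left)
    finally show ?thesis unfolding graded_def using assms(3)[OF ab(1,3)] by (intro span_base) blast
  qed
  then have "graded J \<subseteq> {v. br u v \<in> graded L}" if "u \<in> ?E I" for u
    unfolding graded_def[of J] using that sub
    by (intro span_minimal) (auto simp: subspace_def br.zero_right br.add_right br.scaleR_right)
  then have "graded I \<subseteq> {u. \<forall>v\<in>graded J. br u v \<in> graded L}"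
    unfolding graded_def[of I] using sub
    by (intro span_minimal) (auto simp: subspace_def br.zero_left br.add_left br.scaleR_left)
  with assms(1,2) show ?thesis by blast
qed

lemma graded_add: "u \<in> graded I \<Longrightarrow> v \<in> graded I \<Longrightarrow> u + v \<in> graded I"
  by (simp add: graded_def span_add)

lemma cartan_graded: "x \<in> \<hh> \<Longrightarrow> x \<in> graded {0}"
  unfolding graded_def by (intro span_base) (simp add: abelian d_cartan)

lemma br_d: "br d (e i) = 1 *\<^sub>R e i" "br d (f i) = (-1) *\<^sub>R f i" "br d (h i) = 0 *\<^sub>R h i"
  using br_e[OF d_cartan] br_f[OF d_cartan] abelian[OF d_cartan h_cartan] height_simple by auto

text \<open>A root is a combination of simple roots with natural coefficients, or the negative of one, and
  does not vanish; so its value at \<open>d\<close> is at least \<open>1\<close> in absolute value.\<close>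

lemma triangular_decomposition:
  obtains u x v where "u \<in> graded {..-1}" "x \<in> \<hh>" "v \<in> graded {1..}" "z = u + x + v"
proof -
  let ?E = "\<lambda>I. {v. \<exists>m\<in>I. br d v = m *\<^sub>R v}"
  have "{v. weight_vector v \<and> v \<notin> \<hh>} \<subseteq> ?E {..-1} \<union> ?E {1..}"
  proof clarify
    fix v assume v: "weight_vector v" "v \<notin> \<hh>" and not: "\<not> (\<exists>m\<in>{1..}. br d v = m *\<^sub>R v)"
    obtain k s where s: "s = 1 \<or> s = -1" and k: "\<And>x. x \<in> \<hh> \<Longrightarrow> weight v x = s * (\<Sum>i\<in>UNIV. real (k i :: nat) * \<alpha> i x)"
      by (rule root_combination[OF v]) blast
    have "(\<Sum>i\<in>UNIV. k i) \<noteq> 0"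
    proof
      assume "(\<Sum>i\<in>UNIV. k i) = 0"
      then have "k i = 0" for i by simp
      with weight_vector_root[OF v] k show False by (auto simp: is_root_def)
    qed
    then have "real (\<Sum>i\<in>UNIV. k i) \<ge> 1" by linarith
    moreover have "weight v d = s * real (\<Sum>i\<in>UNIV. k i)"
      using k[OF d_cartan] by (simp add: height_simple)
    moreover have "br d v = weight v d *\<^sub>R v" by (rule br_weight[OF v(1) d_cartan])
    ultimately show "\<exists>m\<in>{..-1}. br d v = m *\<^sub>R v"
      using s not by (intro bexI[of _ "weight v d"]) auto
  qed
  from span_mono[OF this] have sub: "span {v. weight_vector v \<and> v \<notin> \<hh>} \<subseteq> {u + v |u v. u \<in> graded {..-1} \<and> v \<in> graded {1..}}"
    unfolding span_Un graded_def by auto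
  obtain x y where xy: "x \<in> \<hh>" "y \<in> span {v. weight_vector v \<and> v \<notin> \<hh>}" "z = x + y"
    by (rule cartan_decomposition)
  then obtain u v where "u \<in> graded {..-1}" "v \<in> graded {1..}" "y = u + v" using sub by blast
  with xy show ?thesis by (intro that[of u x v]) auto
qed

text \<open>Up to the factor \<open>r\<^sup>2\<close> this is the Poisson bracket of two functions with gradients \<open>X\<close> and \<open>Y\<close>
  in one conjugate pair of coordinates of the Toda lattice of \<open>\<gg>\<close>, after division by \<open>exp (\<phi> i)\<close>.\<close>

definition skew_pairing :: "'g \<Rightarrow> 'g \<Rightarrow> 'n \<Rightarrow> real" where
  "skew_pairing X Y i = K X (h i) * K Y (e i) - K Y (h i) * K X (e i)"

text \<open>Pairing with \<open>e i\<close> sees only the part of height \<open>-1\<close>, that is, the brackets of one Cartan and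
  one lower component. In them \<open>ad\<close> of the Cartan component acts on \<open>e i\<close> through \<open>\<alpha> i\<close>, and
  \<open>\<alpha> i\<close> of the Cartan component of \<open>X\<close> is the pairing of \<open>X\<close> with \<open>h i\<close>.\<close>

lemma skew_pairing_eq:
  assumes X: "X = Xm + X0 + Xp" "Xm \<in> graded {..-1}" "X0 \<in> \<hh>" "Xp \<in> graded {1..}"
    and Y: "Y = Ym + Y0 + Yp" "Ym \<in> graded {..-1}" "Y0 \<in> \<hh>" "Yp \<in> graded {1..}"
  shows "r * skew_pairing X Y i = K (e i) (br (Ym + Y0) (Xm + X0))"
proof -
  have e0: "K (e i) v = 0" if "v \<in> graded I" "-1 \<notin> I" for v I
    using K_graded_eigenvector[OF br_d(1) _ that(1)] that(2) by simp
  have h0: "K (h i) v = 0" if "v \<in> graded I" "0 \<notin> I" for v I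
    using K_graded_eigenvector[OF br_d(3) _ that(1)] that(2) by simp
  have h: "r * K Z (h i) = \<alpha> i Z0" and e: "K Z (e i) = K (e i) Zm"
    if "Z = Zm + Z0 + Zp" "Zm \<in> graded {..-1}" "Z0 \<in> \<hh>" "Zp \<in> graded {1..}" for Z Zm Z0 Zp
    using K_h[OF that(3), of i] h0[OF that(2)] h0[OF that(4)] e0[OF that(4)] e0[OF cartan_graded[OF that(3)]]
    unfolding that(1) K_commute[of _ "h i"] K_commute[of _ "e i"] by (simp_all add: K.add_right)
  have swap: "K (e i) (br Z0 V) = - (\<alpha> i Z0 * K (e i) V)" if "Z0 \<in> \<hh>" for Z0 V
  proof -
    have "K (e i) (br Z0 V) = K (- br Z0 (e i)) V"
      by (subst K_invariant[symmetric], subst br_anticommute) simp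
    then show ?thesis by (simp add: br_e[OF that] K.minus_left K.scaleR_left)
  qed
  have "br Ym Xm \<in> graded {..-2}" using Y(2) X(2) by (rule br_graded) auto
  then have "K (e i) (br (Ym + Y0) (Xm + X0)) = K (e i) (br Ym X0) + K (e i) (br Y0 Xm)"
    by (simp add: br.add_left br.add_right K.add_right abelian X Y K.zero_right e0[of _ "{..-2}"])
  also have "\<dots> = \<alpha> i X0 * K (e i) Ym - \<alpha> i Y0 * K (e i) Xm"
    by (subst br_anticommute[of Ym]) (simp add: swap X Y K.minus_right)
  also have "\<dots> = r * skew_pairing X Y i"
    unfolding skew_pairing_def e[OF X] e[OF Y] h[OF X, symmetric] h[OF Y, symmetric] by (simp add: algebra_simps)
  finally show ?thesis ..
qed

text \<open>The Adler-Kostant-Symes argument in the Takiff algebra: \<open>L + t L'\<close> commutes with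
  \<open>X + t X'\<close> and \<open>Y + t Y'\<close>, and the invariant form pairs \<open>L + t L'\<close> with \<open>U + t U'\<close> to
  \<open>K L U' + K L' U\<close>.\<close>

lemma skew_pairing_gradients:
  assumes L: "L = (\<Sum>i\<in>UNIV. f i + p i *\<^sub>R h i + a i *\<^sub>R e i)"
    and L': "L' = (\<Sum>i\<in>UNIV. f i + q i *\<^sub>R h i + b i *\<^sub>R e i)"
    and X: "br L X = 0" "br L X' + br L' X = 0"
    and Y: "br L Y = 0" "br L Y' + br L' Y = 0"
  shows "(\<Sum>i\<in>UNIV. a i * (skew_pairing X' Y i + skew_pairing X Y' i) + b i * skew_pairing X Y i) = 0"
proof -
  obtain Xm X0 Xp where x: "X = Xm + X0 + Xp" "Xm \<in> graded {..-1}" "X0 \<in> \<hh>" "Xp \<in> graded {1..}"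
    by (rule triangular_decomposition[of X]) blast
  obtain Xm' X0' Xp' where x': "X' = Xm' + X0' + Xp'" "Xm' \<in> graded {..-1}" "X0' \<in> \<hh>" "Xp' \<in> graded {1..}"
    by (rule triangular_decomposition[of X']) blast
  obtain Ym Y0 Yp where y: "Y = Ym + Y0 + Yp" "Ym \<in> graded {..-1}" "Y0 \<in> \<hh>" "Yp \<in> graded {1..}"
    by (rule triangular_decomposition[of Y]) blast
  obtain Ym' Y0' Yp' where y': "Y' = Ym' + Y0' + Yp'" "Ym' \<in> graded {..-1}" "Y0' \<in> \<hh>" "Yp' \<in> graded {1..}"
    by (rule triangular_decomposition[of Y']) blast
  \<comment> \<open>brackets in the lower Borel subalgebra are lower nilpotent, so only the \<open>e i\<close> pair with them\<close>
  have borel: "(\<Sum>i\<in>UNIV. s i * K (e i) (br (V + V0) (U + U0))) =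
      K (\<Sum>i\<in>UNIV. f i + t i *\<^sub>R h i + s i *\<^sub>R e i) (br (V + V0) (U + U0))"
    if "U \<in> graded {..-1}" "U0 \<in> \<hh>" "V \<in> graded {..-1}" "V0 \<in> \<hh>" for U U0 V V0 s t
  proof -
    have "br (V + V0) (U + U0) = br V U + br V0 U + br V U0"
      using abelian that by (simp add: br.add_left br.add_right)
    moreover have "br V U \<in> graded {..-1}" "br V0 U \<in> graded {..-1}" "br V U0 \<in> graded {..-1}"
      using br_graded[OF that(3,1), of "{..-1}"] br_graded[OF cartan_graded[OF that(4)] that(1), of "{..-1}"]
        br_graded[OF that(3) cartan_graded[OF that(2)], of "{..-1}"] by auto
    ultimately have W: "br (V + V0) (U + U0) \<in> graded {..-1}" by (simp add: graded_add)
    then have "K (f i) (br (V + V0) (U + U0)) = 0" "K (h i) (br (V + V0) (U + U0)) = 0" for i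
      using K_graded_eigenvector[OF br_d(2) _ W] K_graded_eigenvector[OF br_d(3) _ W] by auto
    then show ?thesis by (simp add: K.sum_left K.add_left K.scaleR_left)
  qed
  have upper: "K (\<Sum>i\<in>UNIV. f i + t i *\<^sub>R h i + s i *\<^sub>R e i) (br V U) = 0"
    if "U \<in> graded {1..}" "V \<in> graded {1..}" for U V s t
  proof -
    have W: "br V U \<in> graded {2..}" using that(2,1) by (rule br_graded) auto
    then have "K (f i) (br V U) = 0" "K (h i) (br V U) = 0" "K (e i) (br V U) = 0" for i
      using K_graded_eigenvector[OF br_d(1) _ W] K_graded_eigenvector[OF br_d(2) _ W]
        K_graded_eigenvector[OF br_d(3) _ W] by auto
    then show ?thesis by (simp add: K.sum_left K.add_left K.scaleR_left)
  qed
  \<comment> \<open>invariance: the bracket with an element commuting with \<open>L + t L'\<close> is orthogonal to \<open>L + t L'\<close>\<close>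
  have cancel: "K L (br Z' V + br Z V') + K L' (br Z V) = 0"
    if "br L Z = 0" "br L Z' + br L' Z = 0" for Z Z' V V'
  proof -
    have "K L (br Z' V + br Z V') + K L' (br Z V) = K (br L Z' + br L' Z) V + K (br L Z) V'"
      by (simp add: K_invariant K.add_left K.add_right)
    then show ?thesis by (simp add: that K.zero_left)
  qed
  have expand: "br (Vm + V0) (Um + U0) = br (Vm + V0 + Vp) (Um + U0 + Up) - br (Vm + V0 + Vp) Up
      + br (Um + U0 + Up) Vp + br Vp Up" for Um U0 Up Vm V0 Vp
    using br_anticommute[of _ Vp]
    by (simp add: br.add_left br.add_right br_anticommute[of Um Vp] br_anticommute[of U0 Vp] br_anticommute[of Up Vp])
  have "r * (\<Sum>i\<in>UNIV. a i * (skew_pairing X' Y i + skew_pairing X Y' i) + b i * skew_pairing X Y i) =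
    (\<Sum>i\<in>UNIV. a i * K (e i) (br (Ym + Y0) (Xm' + X0'))) + (\<Sum>i\<in>UNIV. a i * K (e i) (br (Ym' + Y0') (Xm + X0)))
     + (\<Sum>i\<in>UNIV. b i * K (e i) (br (Ym + Y0) (Xm + X0)))"
    unfolding skew_pairing_eq[OF x' y, symmetric] skew_pairing_eq[OF x y', symmetric]
      skew_pairing_eq[OF x y, symmetric]
    by (simp add: sum.distrib sum_distrib_left algebra_simps)
  also have "\<dots> = K L (br (Ym + Y0) (Xm' + X0')) + K L (br (Ym' + Y0') (Xm + X0)) + K L' (br (Ym + Y0) (Xm + X0))"
    unfolding L L' borel[OF x'(2,3) y(2,3), where s = a and t = p] borel[OF x(2,3) y'(2,3), where s = a and t = p]
      borel[OF x(2,3) y(2,3), where s = b and t = q] ..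
  also have "\<dots> = (K L (br Y' X + br Y X') + K L' (br Y X)) - (K L (br Y' Xp + br Y Xp') + K L' (br Y Xp))
      + (K L (br X' Yp + br X Yp') + K L' (br X Yp))"
  proof -
    have "K L (br Yp Xp') = 0" "K L (br Yp' Xp) = 0" "K L' (br Yp Xp) = 0"
      unfolding L L' using x x' y y' by (simp_all add: upper)
    then show ?thesis
      unfolding expand[of Ym Y0 Xm X0 Yp Xp] expand[of Ym Y0 Xm' X0' Yp Xp'] expand[of Ym' Y0' Xm X0 Yp' Xp]
        x(1)[symmetric] x'(1)[symmetric] y(1)[symmetric] y'(1)[symmetric]
      by (simp add: K.add_right K.diff_right)
  qed
  also have "\<dots> = 0" using cancel[OF X] cancel[OF Y] by simp
  finally show ?thesis using r_nonzero by simp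
qed

end

section \<open>Density of the points with nonsingular Jacobian matrix\<close>

lemma finite_zeros_real_polynomial_function:
  fixes g :: "real \<Rightarrow> real"
  assumes "real_polynomial_function g" "g s0 \<noteq> 0"
  shows "finite {s. g s = 0}"
proof -
  obtain a n where g: "g = (\<lambda>s. \<Sum>i\<le>n. a i * s ^ i)"
    using assms(1) real_polynomial_function_iff_sum by blast
  with assms(2) obtain i where "i \<le> n" "a i \<noteq> 0"
    by (metis (no_types, lifting) atMost_iff mult_zero_left sum.neutral)
  then show ?thesis unfolding g by (subst polyfun_finite_roots) blast
qed

context toda_frame
begin

lemma real_polynomial_det_jacobian:
  "real_polynomial_function (\<lambda>s::real. det (jacobian k (a + s *\<^sub>R b)))"
proof -
  have "polynomial_function (\<lambda>s::real. (br (a + s *\<^sub>R b) ^^ m) z)" for m z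
  proof (induction m)
    case 0
    then show ?case by simp
  next
    case (Suc m)
    have *: "polynomial_function (\<lambda>s. br c ((br (a + s *\<^sub>R b) ^^ m) z))" for c
      using Suc polynomial_function_compose[OF Suc polynomial_function_bounded_linear[OF br.bounded_linear_right]]
      by (simp add: comp_def)
    have "polynomial_function (\<lambda>s::real. br a ((br (a + s *\<^sub>R b) ^^ m) z) + s *\<^sub>R br b ((br (a + s *\<^sub>R b) ^^ m) z))"
      by (intro polynomial_function_add polynomial_function_mult * polynomial_function_id)
    moreover have "(br (a + s *\<^sub>R b) ^^ Suc m) z =
        br a ((br (a + s *\<^sub>R b) ^^ m) z) + s *\<^sub>R br b ((br (a + s *\<^sub>R b) ^^ m) z)" for s
      by (simp add: br.add_left br.scaleR_left)
    ultimately show ?case by (simp only:)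
  qed
  then have "real_polynomial_function (\<lambda>s::real. (br (a + s *\<^sub>R b) ^^ m) z \<bullet> w)" for m z w
    unfolding polynomial_function_def using bounded_linear_inner_left by (fastforce simp: comp_def)
  then have "real_polynomial_function (\<lambda>s::real. jacobian k (a + s *\<^sub>R b) $ m $ i)" for m i
    unfolding jacobian_def linear_trace_def by (auto intro: real_polynomial_function_sum)
  then have "real_polynomial_function (\<lambda>s::real. of_int (sign p) * (\<Prod>m\<in>UNIV. jacobian k (a + s *\<^sub>R b) $ m $ p m))"
    for p :: "'n \<Rightarrow> 'n"
    by (intro real_polynomial_function.intros(4)[OF real_polynomial_function.intros(2)]
        real_polynomial_function_prod[OF finite])
  then show ?thesis
    unfolding det_def by (rule real_polynomial_function_sum[OF finite_permutations[OF finite]])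
qed

lemma det_jacobian_scaleR:
  "det (jacobian k (c *\<^sub>R a)) = (\<Prod>m\<in>UNIV. c ^ k m) * det (jacobian k a)"
proof -
  have p: "(br (c *\<^sub>R a) ^^ m) z = c ^ m *\<^sub>R (br a ^^ m) z" for m z
    by (induction m) (simp_all add: br.scaleR_left br.scaleR_right)
  have "jacobian k (c *\<^sub>R a) = (\<chi> m. c ^ k m *s jacobian k a $ m)"
    by (simp add: jacobian_def p linear_trace_scaleR vec_eq_iff)
  then show ?thesis by (simp add: det_rows_mul)
qed

text \<open>By homogeneity the value at \<open>a + x / s\<close> is a nonzero multiple of the value at \<open>x + s a\<close>, which is
  nonzero for small \<open>s\<close> by continuity. So the polynomial function on the line is not identically
  zero.\<close>

lemma finite_singular_on_line:
  assumes "det (jacobian k x) \<noteq> 0"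
  shows "finite {s. det (jacobian k (a + s *\<^sub>R x)) = 0}"
proof -
  have "isCont (\<lambda>s. det (jacobian k (x + s *\<^sub>R a))) 0"
    using continuous_real_polymonial_function[OF real_polynomial_det_jacobian] by blast
  then have "\<forall>\<^sub>F s in at 0. det (jacobian k (x + s *\<^sub>R a)) \<noteq> 0"
    using assms by (intro tendsto_imp_eventually_ne) (auto simp: isCont_def)
  then have "\<forall>\<^sub>F s in at 0. det (jacobian k (x + s *\<^sub>R a)) \<noteq> 0 \<and> s \<noteq> 0"
    by (intro eventually_conj eventually_neq_at_within)
  then obtain s where s: "det (jacobian k (x + s *\<^sub>R a)) \<noteq> 0" "s \<noteq> 0"
    using eventually_happens'[OF at_neq_bot] by blast
  have "a + (1 / s) *\<^sub>R x = (1 / s) *\<^sub>R (x + s *\<^sub>R a)" using s(2) by (simp add: scaleR_add_right)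
  then have "det (jacobian k (a + (1 / s) *\<^sub>R x)) \<noteq> 0"
    using s by (simp only: det_jacobian_scaleR) simp
  then show ?thesis by (rule finite_zeros_real_polynomial_function[OF real_polynomial_det_jacobian])
qed

section \<open>The integrals of motion\<close>

text \<open>The two components of the normalized Jacobi element.\<close>

definition lax0 :: "'n coords \<Rightarrow> 'g" where
  "lax0 = (\<lambda>(\<rho>0, \<rho>1, \<phi>0, \<phi>1). \<Sum>i\<in>UNIV. f i + \<rho>0 $ i *\<^sub>R h i + exp (\<phi>0 $ i) *\<^sub>R e i)"

definition lax1 :: "'n coords \<Rightarrow> 'g" where
  "lax1 = (\<lambda>(\<rho>0, \<rho>1, \<phi>0, \<phi>1). \<Sum>i\<in>UNIV. f i + \<rho>1 $ i *\<^sub>R h i + (\<phi>1 $ i * exp (\<phi>0 $ i)) *\<^sub>R e i)"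

definition dlax0 :: "'n coords \<Rightarrow> 'n coords \<Rightarrow> 'g" where
  "dlax0 = (\<lambda>(\<rho>0, \<rho>1, \<phi>0, \<phi>1) (r0, r1, p0, p1).
     \<Sum>i\<in>UNIV. r0 $ i *\<^sub>R h i + (exp (\<phi>0 $ i) * p0 $ i) *\<^sub>R e i)"

definition dlax1 :: "'n coords \<Rightarrow> 'n coords \<Rightarrow> 'g" where
  "dlax1 = (\<lambda>(\<rho>0, \<rho>1, \<phi>0, \<phi>1) (r0, r1, p0, p1).
     \<Sum>i\<in>UNIV. r1 $ i *\<^sub>R h i + (exp (\<phi>0 $ i) * (p1 $ i + \<phi>1 $ i * p0 $ i)) *\<^sub>R e i)"

text \<open>The factor \<open>r\<close> turns the Killing form into \<open>\<kappa>\<close>, so that the second integral for the exponent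
  \<open>k m = 1\<close> is the Hamiltonian itself.\<close>

definition integrals :: "('n \<Rightarrow> nat) \<Rightarrow> 'n coords \<Rightarrow> real ^ ('n + 'n)" where
  "integrals k x = (\<chi> s. case s of
     Inl m \<Rightarrow> r * (linear_trace (br (lax0 x) ^^ Suc (k m)) / real (Suc (k m)))
   | Inr m \<Rightarrow> r * linear_trace (\<lambda>z. (br (lax0 x) ^^ k m) (br (lax1 x) z)))"

lemma bounded_linear_coordinates:
  "bounded_linear (\<lambda>x :: 'n coords. fst x $ i)" "bounded_linear (\<lambda>x :: 'n coords. fst (snd x) $ i)"
  "bounded_linear (\<lambda>x :: 'n coords. fst (snd (snd x)) $ i)" "bounded_linear (\<lambda>x :: 'n coords. snd (snd (snd x)) $ i)"
  by (auto intro!: linear_conv_bounded_linear[THEN iffD1] linearI)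

lemma has_derivative_lax:
  "(lax0 has_derivative dlax0 x) (at x)" "(lax1 has_derivative dlax1 x) (at x)"
proof -
  note [derivative_intros] = bounded_linear_coordinates[THEN bounded_linear_imp_has_derivative]
  have "((\<lambda>x. \<Sum>i\<in>UNIV. f i + fst x $ i *\<^sub>R h i + exp (fst (snd (snd x)) $ i) *\<^sub>R e i) has_derivative
    (\<lambda>v. \<Sum>i\<in>UNIV. fst v $ i *\<^sub>R h i + (exp (fst (snd (snd x)) $ i) * fst (snd (snd v)) $ i) *\<^sub>R e i)) (at x)"
    by (auto intro!: derivative_eq_intros simp: mult.commute)
  then show "(lax0 has_derivative dlax0 x) (at x)"
    by (simp add: lax0_def dlax0_def case_prod_unfold)
  have "((\<lambda>x. \<Sum>i\<in>UNIV. f i + fst (snd x) $ i *\<^sub>R h i + (snd (snd (snd x)) $ i * exp (fst (snd (snd x)) $ i)) *\<^sub>R e i) has_derivative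
    (\<lambda>v. \<Sum>i\<in>UNIV. fst (snd v) $ i *\<^sub>R h i + (exp (fst (snd (snd x)) $ i) *
       (snd (snd (snd v)) $ i + snd (snd (snd x)) $ i * fst (snd (snd v)) $ i)) *\<^sub>R e i)) (at x)"
    by (auto intro!: derivative_eq_intros simp: algebra_simps)
  then show "(lax1 has_derivative dlax1 x) (at x)"
    by (simp add: lax1_def dlax1_def case_prod_unfold)
qed

lemma has_derivative_integrals:
  "((\<lambda>x. integrals k x $ Inl m) has_derivative (\<lambda>v. r *
     linear_trace (\<lambda>z. (br (lax0 x) ^^ k m) (br (dlax0 x v) z)))) (at x)"
  "((\<lambda>x. integrals k x $ Inr m) has_derivative (\<lambda>v. r *
     (linear_trace (\<lambda>z. (br (lax0 x) ^^ k m) (br (dlax1 x v) z)) +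
      linear_trace (\<lambda>z. ad_pow_deriv (k m) (lax0 x) (lax1 x) (br (dlax0 x v) z))))) (at x)"
  unfolding integrals_def vec_lambda_beta sum.case
  by (intro has_derivative_mult_right has_derivative_trace_power has_derivative_trace_power_times has_derivative_lax)+

lemma smooth_on_integrals:
  fixes S :: "'n coords set" assumes "open S" shows "smooth_on S (integrals k)"
proof -
  have lax: "smooth_on S lax0" "smooth_on S lax1"
    unfolding lax0_def lax1_def case_prod_unfold
    by (intro smooth_on_sum smooth_on_add smooth_on_const smooth_on_bilinear[OF assms bounded_bilinear_scaleR]
        smooth_on_bilinear[OF assms bounded_bilinear_mult] smooth_on_exp
        smooth_on_bounded_linear bounded_linear_coordinates assms)+
  have tr: "smooth_on S (\<lambda>x. linear_trace (M x))" if "\<And>z. smooth_on S (\<lambda>x. M x z)" for M :: "'n coords \<Rightarrow> 'g \<Rightarrow> 'g"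
    unfolding linear_trace_def
    by (intro smooth_on_sum assms smooth_on_bilinear[OF assms bounded_bilinear_inner] that smooth_on_const)
  note pow = smooth_on_bracket_power[OF assms br.bounded_bilinear_axioms]
  have "smooth_on S (\<lambda>x. r * (1 / real (Suc n) * linear_trace (br (lax0 x) ^^ Suc n)))"
    "smooth_on S (\<lambda>x. r * linear_trace (\<lambda>z. (br (lax0 x) ^^ n) (br (lax1 x) z)))" for n
    by (intro smooth_on_bilinear[OF assms bounded_bilinear_mult] smooth_on_const[OF assms] tr pow lax
        smooth_on_bilinear[OF assms br.bounded_bilinear_axioms])+
  note this[unfolded times_divide_eq_left mult_1_left]
  then have "smooth_on S (\<lambda>x. case s of
     Inl m \<Rightarrow> r * (linear_trace (br (lax0 x) ^^ Suc (k m)) / real (Suc (k m)))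
   | Inr m \<Rightarrow> r * linear_trace (\<lambda>z. (br (lax0 x) ^^ k m) (br (lax1 x) z)))" for s
    by (cases s) (simp_all only: sum.case)
  then show ?thesis unfolding integrals_def by (intro smooth_on_vec assms)
qed

lemma derivative_in_coordinates:
  assumes "(G has_derivative (\<lambda>v. r * (K X (dlax1 x v) + K X' (dlax0 x v)))) (at x)"
    and x: "x = (\<rho>0, \<rho>1, \<phi>0, \<phi>1)"
  shows "(G has_derivative (\<lambda>(r0, r1, p0, p1).
     (\<chi> i. r * K X' (h i)) \<bullet> r0 + (\<chi> i. r * K X (h i)) \<bullet> r1 +
     (\<chi> i. r * exp (\<phi>0 $ i) * (K X' (e i) + \<phi>1 $ i * K X (e i))) \<bullet> p0 +
     (\<chi> i. r * exp (\<phi>0 $ i) * K X (e i)) \<bullet> p1)) (at x)"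
proof (rule has_derivative_eq_rhs[OF assms(1)], intro ext)
  fix v :: "'n coords"
  obtain r0 r1 p0 p1 where v: "v = (r0, r1, p0, p1)" by (metis prod.exhaust)
  show "r * (K X (dlax1 x v) + K X' (dlax0 x v)) = (\<lambda>(r0, r1, p0, p1).
     (\<chi> i. r * K X' (h i)) \<bullet> r0 + (\<chi> i. r * K X (h i)) \<bullet> r1 +
     (\<chi> i. r * exp (\<phi>0 $ i) * (K X' (e i) + \<phi>1 $ i * K X (e i))) \<bullet> p0 +
     (\<chi> i. r * exp (\<phi>0 $ i) * K X (e i)) \<bullet> p1) v"
    by (simp add: x v dlax0_def dlax1_def K.sum_right K.add_right K.scaleR_right inner_vec_def
        sum_distrib_left algebra_simps flip: sum.distrib)
qed

text \<open>\<open>X + t X'\<close> is the gradient in the Takiff algebra. As the invariant form there pairs the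
  coefficients of \<open>1\<close> and \<open>t\<close> crosswise, a function of \<open>L0\<close> alone has a gradient with \<open>X = 0\<close>.\<close>

lemma exists_gradient_integrals:
  obtains X X' where "((\<lambda>y. integrals k y $ s) has_derivative
      (\<lambda>v. r * (K X (dlax1 x v) + K X' (dlax0 x v)))) (at x)"
    "br (lax0 x) X = 0" "br (lax0 x) X' + br (lax1 x) X = 0"
proof (cases s)
  case (Inl m)
  show ?thesis
    by (rule that[of 0 "gradient (br (lax0 x) ^^ k m)"])
       (use has_derivative_integrals(1)[of k m x] Inl in
         \<open>simp_all add: K_gradient[OF linear_br_power] K.zero_left br.zero_right br_gradient_power\<close>)
next
  case (Inr m)
  show ?thesis
    by (rule that[of "gradient (br (lax0 x) ^^ k m)" "gradient (ad_pow_deriv (k m) (lax0 x) (lax1 x))"])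
       (use has_derivative_integrals(2)[of k m x] Inr in
         \<open>simp_all add: K_gradient[OF linear_br_power] K_gradient[OF linear_ad_pow_deriv]
            br_gradient_power br_gradient_deriv\<close>)
qed

lemma poisson_bracket_integrals:
  "poisson_bracket omega_Z (\<lambda>y. integrals k y $ s) (\<lambda>y. integrals k y $ s') x = 0"
proof -
  obtain \<rho>0 \<rho>1 \<phi>0 \<phi>1 where x: "x = (\<rho>0, \<rho>1, \<phi>0, \<phi>1)" by (metis prod.exhaust)
  obtain X X' where X: "((\<lambda>y. integrals k y $ s) has_derivative
      (\<lambda>v. r * (K X (dlax1 x v) + K X' (dlax0 x v)))) (at x)"
    "br (lax0 x) X = 0" "br (lax0 x) X' + br (lax1 x) X = 0" by (rule exists_gradient_integrals)
  obtain Y Y' where Y: "((\<lambda>y. integrals k y $ s') has_derivative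
      (\<lambda>v. r * (K Y (dlax1 x v) + K Y' (dlax0 x v)))) (at x)"
    "br (lax0 x) Y = 0" "br (lax0 x) Y' + br (lax1 x) Y = 0" by (rule exists_gradient_integrals)
  have l: "lax0 x = (\<Sum>i\<in>UNIV. f i + \<rho>0 $ i *\<^sub>R h i + exp (\<phi>0 $ i) *\<^sub>R e i)"
    "lax1 x = (\<Sum>i\<in>UNIV. f i + \<rho>1 $ i *\<^sub>R h i + (\<phi>1 $ i * exp (\<phi>0 $ i)) *\<^sub>R e i)"
    by (simp_all add: x lax0_def lax1_def)
  have "poisson_bracket omega_Z (\<lambda>y. integrals k y $ s) (\<lambda>y. integrals k y $ s') x = r\<^sup>2 *
    (\<Sum>i\<in>UNIV. exp (\<phi>0 $ i) * (skew_pairing X' Y i + skew_pairing X Y' i) + (\<phi>1 $ i * exp (\<phi>0 $ i)) * skew_pairing X Y i)"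
    unfolding poisson_bracket_omega_Z[OF derivative_in_coordinates[OF X(1) x] derivative_in_coordinates[OF Y(1) x]]
    by (simp add: inner_vec_def skew_pairing_def sum_distrib_left power2_eq_square algebra_simps
        flip: sum.distrib sum_subtractf)
  then show ?thesis using skew_pairing_gradients[OF l X(2,3) Y(2,3)] by simp
qed

lemma hamiltonian_eq_K_lax:
  assumes "\<And>i j. c $ i $ j = r * K (h i) (h j)"
  shows "hamiltonian c x = r * K (lax0 x) (lax1 x)"
proof -
  obtain \<rho>0 \<rho>1 \<phi>0 \<phi>1 where x: "x = (\<rho>0, \<rho>1, \<phi>0, \<phi>1)" by (metis prod.exhaust)
  have "K (f i) (f j) = 0" "K (f i) (h j) = 0" "K (h i) (f j) = 0" "K (h i) (e j) = 0"
    "K (e i) (h j) = 0" "K (e i) (e j) = 0" for i j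
    by (rule K_eigenvectors[OF br_d(2) br_d(2)] K_eigenvectors[OF br_d(2) br_d(3)]
        K_eigenvectors[OF br_d(3) br_d(2)] K_eigenvectors[OF br_d(3) br_d(1)]
        K_eigenvectors[OF br_d(1) br_d(3)] K_eigenvectors[OF br_d(1) br_d(1)], simp)+
  moreover have "K (e i) (f j) = (if i = j then 1 / r else 0)" for i j
    using K_e_f[of i j] r_nonzero by (auto simp: field_simps split: if_splits)
  moreover have "K (f i) (e j) = (if i = j then 1 / r else 0)" for i j
    using K_e_f[of j i] r_nonzero by (auto simp: K_commute[of "f i"] field_simps split: if_splits)
  ultimately show ?thesis
    unfolding x hamiltonian_def lax0_def lax1_def using r_nonzero
    by (simp add: K.sum_left K.sum_right K.add_left K.add_right K.scaleR_left K.scaleR_right assms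
        sum.distrib sum_distrib_left if_distrib[of "\<lambda>c. _ * c"] algebra_simps cong: if_cong)
      (rule sum.swap)
qed

lemma open_phase_space: "open (phase_space :: 'n coords set)"
proof -
  have "phase_space = (\<Inter>i. {x :: 'n coords. 0 < snd (snd (snd x)) $ i})"
    by (auto simp: phase_space_def)
  moreover have "open \<dots>"
    by (auto intro!: open_INT open_Collect_less continuous_intros)
  ultimately show ?thesis by (simp only:)
qed

lemma continuous_on_det_jacobian: "continuous_on S (\<lambda>x. det (jacobian k (lax0 x)))"
proof -
  have lax: "continuous_on S lax0"
    by (rule continuous_at_imp_continuous_on) (metis has_derivative_continuous has_derivative_lax(1))
  have "continuous_on S (\<lambda>x. (br (lax0 x) ^^ m) z)" for m z
    by (induction m) (auto intro: br.continuous_on lax continuous_on_const)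
  then show ?thesis
    unfolding det_def jacobian_def linear_trace_def by (simp, intro continuous_intros)
qed

text \<open>Moving \<open>\<rho>0\<close> by \<open>s \<rho>\<close> stays in the phase space and moves \<open>L0\<close> along a line on which the
  Jacobian is singular only finitely often, which gives density. Variation of \<open>\<rho>1\<close> leaves \<open>L0\<close>
  fixed and so tests only the second half of the coefficients; once these vanish, variation of
  \<open>\<rho>0\<close> tests the first half with the same matrix.\<close>

lemma functionally_independent_integrals:
  assumes "det (jacobian k (\<Sum>i\<in>UNIV. \<rho> $ i *\<^sub>R h i)) \<noteq> 0"
  shows "functionally_independent_on phase_space (integrals k)"
  unfolding functionally_independent_on_def
proof (intro exI conjI ballI allI impI)
  let ?U = "{x \<in> phase_space. det (jacobian k (lax0 x)) \<noteq> 0}"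
  show "open ?U"
    using continuous_open_preimage[OF continuous_on_det_jacobian[of phase_space k] open_phase_space, of "- {0}"]
    by (simp add: vimage_def Int_def open_Compl)
  show "?U \<subseteq> phase_space" by auto
  show "phase_space \<subseteq> closure ?U"
  proof
    fix x :: "'n coords" assume xM: "x \<in> phase_space"
    obtain \<rho>0 \<rho>1 \<phi>0 \<phi>1 where x: "x = (\<rho>0, \<rho>1, \<phi>0, \<phi>1)" by (metis prod.exhaust)
    show "x \<in> closure ?U"
      unfolding closure_approachable
    proof (intro allI impI)
      fix \<epsilon> :: real assume "\<epsilon> > 0"
      define \<delta> where "\<delta> = \<epsilon> / (norm \<rho> + 1)"
      have "\<delta> > 0" using \<open>\<epsilon> > 0\<close> by (simp add: \<delta>_def add_nonneg_pos)
      then have "\<not> {0<..<\<delta>} \<subseteq> {s. det (jacobian k (lax0 x + s *\<^sub>R (\<Sum>i\<in>UNIV. \<rho> $ i *\<^sub>R h i))) = 0}"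
        using finite_singular_on_line[OF assms, of "lax0 x"] finite_subset infinite_Ioo by blast
      then obtain s where s: "s \<in> {0<..<\<delta>}"
        "s \<notin> {s. det (jacobian k (lax0 x + s *\<^sub>R (\<Sum>i\<in>UNIV. \<rho> $ i *\<^sub>R h i))) = 0}" by blast
      let ?y = "(\<rho>0 + s *\<^sub>R \<rho>, \<rho>1, \<phi>0, \<phi>1)"
      have "lax0 ?y = lax0 x + s *\<^sub>R (\<Sum>i\<in>UNIV. \<rho> $ i *\<^sub>R h i)"
        by (simp add: x lax0_def scaleR_sum_right scaleR_add_left algebra_simps flip: sum.distrib)
      then have "?y \<in> ?U" using s(2) xM by (simp add: x phase_space_def)
      moreover have "dist ?y x < \<epsilon>"
      proof -
        have "dist ?y x = s * norm \<rho>" using s(1) by (simp add: x dist_Pair_Pair dist_norm)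
        also have "\<dots> \<le> s * (norm \<rho> + 1)" using s(1) by simp
        also have "\<dots> < \<delta> * (norm \<rho> + 1)" using s(1) by (intro mult_strict_right_mono) (auto simp: add_nonneg_pos)
        also have "\<dots> = \<epsilon>" by (simp add: \<delta>_def add_nonneg_eq_0_iff)
        finally show ?thesis .
      qed
      ultimately show "\<exists>y\<in>?U. dist y x < \<epsilon>" by blast
    qed
  qed
  fix x and a :: "real ^ ('n + 'n)"
  assume x: "x \<in> ?U"
    and a: "\<forall>v. (\<Sum>i\<in>UNIV. a $ i * frechet_derivative (\<lambda>y. integrals k y $ i) (at x) v) = 0"
  obtain \<rho>0 \<rho>1 \<phi>0 \<phi>1 where x': "x = (\<rho>0, \<rho>1, \<phi>0, \<phi>1)" by (metis prod.exhaust)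
  let ?J = "jacobian k (lax0 x)"
  have rows: "b m = 0" if "\<And>i. (\<Sum>m\<in>UNIV. b m * (r * ?J $ m $ i)) = 0" for b :: "'n \<Rightarrow> real" and m
  proof -
    have "r * (\<Sum>m\<in>UNIV. b m * ?J $ m $ i) = 0" for i
      using that[of i] by (simp add: sum_distrib_left mult.left_commute)
    then have "transpose ?J *v (\<chi> m. b m) = 0"
      using r_nonzero by (simp add: vec_eq_iff matrix_vector_mult_def transpose_def mult.commute)
    moreover have "det (transpose ?J) \<noteq> 0" using x by (simp add: det_transpose)
    ultimately have "(\<chi> m. b m) = 0"
      by (metis invertible_det_nz invertible_left_inverse matrix_left_invertible_ker)
    then show ?thesis by (simp add: vec_eq_iff)
  qed
  note D = frechet_derivative_at[OF has_derivative_integrals(1), symmetric]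
    frechet_derivative_at[OF has_derivative_integrals(2), symmetric]
  have a: "(\<Sum>m\<in>UNIV. a $ Inl m * frechet_derivative (\<lambda>y. integrals k y $ Inl m) (at x) v) +
      (\<Sum>m\<in>UNIV. a $ Inr m * frechet_derivative (\<lambda>y. integrals k y $ Inr m) (at x) v) = 0" for v
    using spec[OF a, of v] by (simp add: UNIV_Plus_UNIV[symmetric] sum.Plus del: UNIV_Plus_UNIV)
  have z: "linear_trace (\<lambda>z. (br b ^^ n) (br 0 z)) = 0" "linear_trace (\<lambda>z. ad_pow_deriv n b b' (br 0 z)) = 0" for n b b'
    using linear_0[OF linear_br_power] linear_0[OF linear_ad_pow_deriv]
    by (simp_all add: br.zero_left linear_trace_def)
  have "dlax0 x (0, axis i 1, 0, 0) = 0" "dlax1 x (0, axis i 1, 0, 0) = h i"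
    "dlax0 x (axis i 1, 0, 0, 0) = h i" "dlax1 x (axis i 1, 0, 0, 0) = 0" for i
    by (simp_all add: x' dlax0_def dlax1_def axis_def if_distrib[of "\<lambda>c. c *\<^sub>R _"] cong: if_cong)
  note dlax = this
  have "(\<Sum>m\<in>UNIV. a $ Inr m * (r * ?J $ m $ i)) = 0" for i
    using a[of "(0, axis i 1, 0, 0)"] by (simp add: D dlax z jacobian_def)
  then have Inr: "a $ Inr m = 0" for m by (rule rows)
  have "(\<Sum>m\<in>UNIV. a $ Inl m * (r * ?J $ m $ i)) = 0" for i
    using a[of "(axis i 1, 0, 0, 0)"] by (simp add: D dlax z jacobian_def Inr)
  then have "a $ Inl m = 0" for m by (rule rows)
  with Inr have "a $ s = 0" for s by (cases s) simp_all
  then show "a = 0" by (simp add: vec_eq_iff)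
qed

theorem liouville_integrable:
  assumes c: "\<And>i j. c $ i $ j = r * K (h i) (h j)"
  shows "\<exists>F :: 'n coords \<Rightarrow> real ^ ('n + 'n). liouville_integrable_by phase_space omega_Z (hamiltonian c) F"
proof -
  obtain \<rho> :: "real ^ 'n" and k i0 where k: "k i0 = 1" "det (jacobian k (\<Sum>i\<in>UNIV. \<rho> $ i *\<^sub>R h i)) \<noteq> 0"
    by (rule exists_nonsingular_jacobian)
  have H: "hamiltonian c = (\<lambda>x. integrals k x $ Inr i0)"
    by (rule ext) (simp add: hamiltonian_eq_K_lax[OF c] integrals_def k(1) K_eq_trace)
  have "smooth_on phase_space (hamiltonian c)"
  proof -
    have "smooth_on phase_space (\<lambda>x. integrals k x \<bullet> axis (Inr i0) 1)"
      by (intro smooth_on_bilinear[OF open_phase_space bounded_bilinear_inner]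
          smooth_on_integrals smooth_on_const open_phase_space)
    then show ?thesis by (simp add: H inner_axis)
  qed
  then have "liouville_integrable_by phase_space omega_Z (hamiltonian c) (integrals k)"
    unfolding liouville_integrable_by_def
    using open_phase_space symplectic_form_omega_Z smooth_on_integrals[OF open_phase_space]
      poisson_bracket_integrals functionally_independent_integrals[OF k(2)] H
    by auto
  then show ?thesis by blast
qed

end

theorem theorem7p1:
  fixes br :: "'g::euclidean_space \<Rightarrow> 'g \<Rightarrow> 'g"
    and \<hh> :: "'g set"
    and \<alpha> :: "'n::finite \<Rightarrow> 'g \<Rightarrow> real"
    and \<kappa> :: "'g \<Rightarrow> 'g \<Rightarrow> real"
    and r :: real
    and c :: "real ^ 'n ^ 'n"
  assumes "simple_lie_algebra br"
    and "split_cartan_subalgebra br \<hh>"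
    and "simple_roots br \<hh> \<alpha>"
    and "c = cartan_matrix br \<hh> \<alpha>"
    and "r > 0"
    and "\<kappa> = (\<lambda>x y. r * killing_form br x y)"
    and "\<And>i. dual_form \<kappa> \<hh> (\<alpha> i) (\<alpha> i) = 2"
    and "\<And>i j. dual_form \<kappa> \<hh> (\<alpha> i) (\<alpha> j) = c $ i $ j"
  shows "\<exists>F :: 'n coords \<Rightarrow> real ^ ('n + 'n).
           liouville_integrable_by phase_space omega_Z (hamiltonian c) F"
proof -
  interpret lie br
    using assms(1) by unfold_locales (simp add: simple_lie_algebra_def)
  define rad where "rad = {x. \<forall>y. K x y = 0}"
  \<comment> \<open>the radical of the Killing form is an ideal, and a zero Killing form contradicts the normalization\<close>
  have "lie_ideal br rad"
    by (auto simp: lie_ideal_def rad_def subspace_def K.zero_left K.add_left K.scaleR_left)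
       (metis K.minus_left K_invariant br_anticommute minus_zero)
  then have "rad = {0} \<or> rad = UNIV" using assms(1) by (simp add: simple_lie_algebra_def)
  moreover have "rad \<noteq> UNIV"
  proof
    assume "rad = UNIV"
    then have "\<kappa> x y = 0" for x y using assms(6) by (auto simp: rad_def)
    then show False using assms(7)[of undefined] by (simp add: dual_form_def)
  qed
  ultimately have "rad = {0}" by blast
  then interpret split_lie br \<hh>
    by unfold_locales (use assms(2) in \<open>auto simp: rad_def\<close>)
  define h where "h i = dual_vector \<kappa> \<hh> (\<alpha> i)" for i
  have h: "h i \<in> \<hh> \<and> (\<forall>x\<in>\<hh>. \<kappa> (h i) x = \<alpha> i x)" for i
    unfolding h_def dual_vector_def
  proof (rule theI')
    have "is_root br \<hh> (\<alpha> i)" using assms(3) by (auto simp: simple_roots_def)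
    then obtain v where v: "v \<noteq> 0" "\<And>x. x \<in> \<hh> \<Longrightarrow> br x v = \<alpha> i x *\<^sub>R v" by (auto simp: is_root_def)
    have "linear (\<lambda>x. weight v x / r)"
      by (rule linear_compose_scale_right[OF linear_weight, of "1 / r" v, simplified])
    then obtain t where t: "t \<in> \<hh>" "\<And>x. x \<in> \<hh> \<Longrightarrow> K t x = weight v x / r"
      by (metis represent_functional_on_cartan)
    then have t': "\<kappa> t x = \<alpha> i x" if "x \<in> \<hh>" for x
      using weight_unique[OF v(2)[OF that] v(1)] that assms(5,6) by simp
    moreover have "s = t" if s: "s \<in> \<hh>" "\<forall>x\<in>\<hh>. \<kappa> s x = \<alpha> i x" for s
    proof -
      have "K (s - t) x = 0" if "x \<in> \<hh>" for x
      proof -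
        have "r * K s x = r * K t x" using s(2) t'[OF that] that assms(6) by simp
        then show ?thesis using assms(5) by (simp add: K.diff_left)
      qed
      then have "s - t = 0"
        using s(1) t(1) by (intro nondegenerate_on_cartan) (auto intro: subspace_diff subspace_cartan)
      then show ?thesis by simp
    qed
    ultimately show "\<exists>!t. t \<in> \<hh> \<and> (\<forall>x\<in>\<hh>. \<kappa> t x = \<alpha> i x)" using t(1) by blast
  qed
  obtain e f d where "toda_frame br \<hh> \<alpha> r h e f d"
    by (rule exists_toda_frame[OF assms(3), of r h]) (use assms(5,6) h in auto)
  then interpret toda_frame br \<hh> \<alpha> r h e f d .
  show ?thesis
    by (rule liouville_integrable) (use assms(6,8) in \<open>simp add: dual_form_def h_def\<close>)
qed

end
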